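(* It is undecidable, given a checking stack automaton (CSA) $M$, whether $M$ accepts in weak space $\sigma^{\rm w}_M(n)\in O(1)$ or not.
   Context: **Stack automata.** A one-way nondeterministic stack automaton (SA) is a 6-tuple $M=(Q,\Sigma,\Gamma,\delta,q_0,F)$: $Q$ is a finite set of states; $\Sigma,\Gamma$ are the (finite) input and stack alphabets; $\Gamma$ contains two special symbols $\triangleright$ (bottom marker) and $\triangleleft$ (top marker), and $\Gamma_0=\Gamma\setminus\{\triangleright,\triangleleft\}$; $q_0\in Q$ is the initial state; $F\subseteq Q$ is the set of final states; $\delta$ is a nondeterministic transition function from $Q\times(\Sigma\cup\{\lambda\})\times\Gamma$ into subsets of $Q\times\{\mathtt{stay},\mathtt{push}(x),\mathtt{pop},-1,0,+1 \mid x\in\Gamma_0\}$ ($\lambda$ is the empty word). Write $(q,a,y)\to(p,\iota)$ for $(p,\iota)\in\delta(q,a,y)$. A configuration is a triple $c=(q,w,\gamma)$ with $q\in Q$ the current state, $w\in\Sigma^*$ the remaining input, and $\gamma\in \triangleright\Gamma_0^*\uparrow\Gamma_0^*\triangleleft$ or $\gamma\in\triangleright\Gamma_0^*\triangleleft\uparrow$, where $\uparrow\notin\Gamma$ marks the stack head, which scans the symbol directly preceding it. The stack size of $c$ is $\|c\|_\Gamma=|\gamma|-3$ (number of symbols of $\Gamma_0$ on the stack). Write relation $\vdash_w$: if $(q,a,x)\to(p,\iota)$ with $x\in\Gamma_0\cup\{\triangleright\}$, $a\in\Sigma\cup\{\lambda\}$, then for $u\in\Sigma^*$ and $\gamma x\triangleleft\in\triangleright\Gamma_0^*\triangleleft$: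 $(q,au,\gamma x\uparrow\triangleleft)\vdash_w(p,u,\gamma x\uparrow\triangleleft)$ if $\iota=\mathtt{stay}$; $(q,au,\gamma x\uparrow\triangleleft)\vdash_w(p,u,\gamma xy\uparrow\triangleleft)$ if $\iota=\mathtt{push}(y)$; $(q,au,\gamma x\uparrow\triangleleft)\vdash_w(p,u,\gamma\uparrow\triangleleft)$ if $\iota=\mathtt{pop}$ and $x\ne\triangleright$. (These moves are undefined if the head is not at the topmost stack symbol.) Read relation $\vdash_r$: if $(q,a,x)\to(p,\iota)$ with $x\in\Gamma$, then for $u\in\Sigma^*$ and $\gamma_1x\gamma_2\in\triangleright\Gamma_0^*\triangleleft$: $(q,au,\gamma_1x\uparrow\gamma_2)\vdash_r(p,u,\gamma_1\uparrow x\gamma_2)$ if $\iota=-1$ and $x\neq\triangleright$; $(q,au,\gamma_1x\uparrow\gamma_2)\vdash_r(p,u,\gamma_1x\uparrow\gamma_2)$ if $\iota=0$; $(q,au,\gamma_1x\uparrow\gamma_2)\vdash_r(p,u,\gamma_1xy\uparrow\gamma_2')$ if $\iota=+1$ and $\gamma_2=y\gamma_2'$, $y\in\Gamma$. Let $\vdash=\vdash_w\cup\vdash_r$. A partial computation on $u\in\Sigma^*$ is a finite sequence of configurations $c_0\vdash\cdots\vdash c_m$ with $c_0=(q_0,u,\triangleright\uparrow\triangleleft)$. It is a computation if the remaining input in $c_m$ is $\lambda$, and an accepting computation if moreover the state of $c_m$ is in $F$. Its stack size is $\|\mathcal C\|_\Gamma=\max_j\|c_j\|_\Gamma$. The accepted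 language $L(M)$ is the set of words on which $M$ has an accepting computation. An SA has partitioned states if $Q$ is a disjoint union $Q_w\cup Q_r$ (write states and read states), $F\subseteq Q_r$, all transitions from states in $Q_w$ have $\iota\in\{\mathtt{stay},\mathtt{push}(x),\mathtt{pop}\}$ and all transitions from states in $Q_r$ have $\iota\in\{-1,0,+1\}$. An SA is non-erasing (NESA) if it has no $\mathtt{pop}$ transitions. A checking stack automaton (CSA) is a NESA with partitioned states and with no transitions from a read state to a write state. **Weak space measure.** For $u\in\Sigma^*$, $\sigma^{\rm w}_M(u)$ is the minimum of $\|\mathcal C\|_\Gamma$ over accepting computations $\mathcal C$ of $M$ on $u$ if $u\in L(M)$, and $0$ if $u\notin L(M)$. For $n\in\mathbb{N}$, $\sigma^{\rm w}_M(n)=\max\{\sigma^{\rm w}_M(u)\mid u\in\Sigma^*, |u|=n\}$. The input to the decision problem is a (finite) description of $M$. *)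

theory Defs
  imports Complex_Main "HOL-Library.Landau_Symbols" "HOL-Library.Nat_Bijection"
begin

section \<open>Partial recursive functions and decidability\<close>

datatype recf =
    Zero
  | Succ
  | Proj nat
  | Comp recf "recf list"
  | PrimRec recf recf
  | Mu recf

text \<open>
  \<open>computes f xs y\<close>: the partial recursive function described by \<open>f\<close> is defined on the
  argument tuple \<open>xs\<close>, with value \<open>y\<close>. An expression used with a wrong number of arguments
  has no value; the constant zero is available in every arity.
\<close>

inductive computes :: "recf \<Rightarrow> nat list \<Rightarrow> nat \<Rightarrow> bool" where
  zero: "computes Zero xs 0"
| succ: "computes Succ [x] (Suc x)"
| proj: "i < length xs \<Longrightarrow> computes (Proj i) xs (xs ! i)"
| comp: "list_all2 (\<lambda>g y. computes g xs y) gs ys \<Longrightarrow> computes f ys z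
    \<Longrightarrow> computes (Comp f gs) xs z"
| primrec_0: "computes f xs y \<Longrightarrow> computes (PrimRec f g) (0 # xs) y"
| primrec_Suc: "computes (PrimRec f g) (n # xs) y \<Longrightarrow> computes g (n # y # xs) z
    \<Longrightarrow> computes (PrimRec f g) (Suc n # xs) z"
| mu: "computes f (n # xs) 0 \<Longrightarrow> \<forall>m<n. \<exists>k. computes f (m # xs) (Suc k)
    \<Longrightarrow> computes (Mu f) xs n"

inductive_cases computes_elims:
  "computes Zero xs y"
  "computes Succ xs y"
  "computes (Proj i) xs y"
  "computes (Comp f gs) xs y"
  "computes (PrimRec f g) (0 # xs) y"
  "computes (PrimRec f g) (Suc n # xs) y"
  "computes (Mu f) xs y"

lemma computes_deterministic:
  "computes f xs y \<Longrightarrow> computes f xs z \<Longrightarrow> y = z"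
proof (induction f xs y arbitrary: z rule: computes.induct)
  case (comp xs gs ys f y)
  from comp.prems obtain ys' where ys': "list_all2 (\<lambda>g y. computes g xs y) gs ys'" "computes f ys' z"
    by (rule computes_elims(4))
  have "ys = ys'"
    using comp.IH(1) ys'(1) unfolding list_all2_conv_all_nth by (metis nth_equalityI)
  with comp.IH ys'(2) show ?case by blast
next
  case (mu f n xs)
  from mu.prems have z: "computes f (z # xs) 0" "\<forall>m<z. \<exists>k. computes f (m # xs) (Suc k)"
    by (auto elim: computes_elims(7))
  have "\<not> n < z"
    using mu.IH(1) z(2) by (metis nat.distinct(1))
  moreover have "\<not> z < n"
    using mu.IH(2) z(1) by (metis nat.distinct(1))
  ultimately show ?case by simp
next
  case (primrec_0 f xs y g)
  from primrec_0.prems have "computes f xs z" by (rule computes_elims(5))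
  then show ?case by (rule primrec_0.IH)
next
  case (primrec_Suc f g n xs y z')
  from primrec_Suc.prems obtain y' where y': "computes (PrimRec f g) (n # xs) y'" "computes g (n # y' # xs) z"
    by (rule computes_elims(6))
  with primrec_Suc.IH show ?case by blast
next
  case (zero xs)
  then show ?case by (auto elim: computes_elims(1))
next
  case (succ x)
  then show ?case by (auto elim: computes_elims(2))
next
  case (proj i xs)
  from proj.prems show ?case by (auto elim: computes_elims(3))
qed

text \<open>
  A decision problem asks whether \<open>P x\<close> holds, given an instance \<open>x \<in> D\<close> presented as
  the number \<open>code x\<close>. A decision procedure only has to terminate, and to be correct, on the
  codes of instances; nothing is required of it on other numbers.
\<close>

definition decidable_problem :: "'i set \<Rightarrow> ('i \<Rightarrow> nat) \<Rightarrow> ('i \<Rightarrow> bool) \<Rightarrow> bool" where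
  "decidable_problem D code P \<longleftrightarrow>
     (\<exists>f. \<forall>x\<in>D. computes f [code x] (if P x then 1 else 0))"


section \<open>Stack automata\<close>

text \<open>
  \<open>Bot\<close> and \<open>Top\<close> are the two stack markers, so that \<open>\<Gamma>\<close> consists of \<open>Bot\<close>, \<open>Top\<close> and
  \<open>Sym g\<close> for \<open>g \<in> \<Gamma>\<^sub>0\<close>. The head movements \<open>-1\<close>, \<open>0\<close>, \<open>+1\<close> are \<open>Down\<close>, \<open>Hold\<close>, \<open>Up\<close>;
  \<open>Hold\<close> is distinct from the write instruction \<open>Stay\<close>.
\<close>

datatype 'g cell = Bot | Top | Sym 'g

datatype 'g instr = Stay | Push 'g | Pop | Down | Hold | Up

text \<open>
  The transition function is given by its graph: \<open>(q, a, y, p, \<iota>) \<in> sa_delta M\<close> stands for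
  \<open>(q, a, y) \<rightarrow> (p, \<iota>)\<close>, where \<open>a = None\<close> is a move on the empty word.
\<close>

record ('q, 'a, 'g) sa =
  sa_states :: "'q set"
  sa_inputs :: "'a set"
  sa_syms :: "'g set"  \<comment> \<open>the alphabet \<open>\<Gamma>\<^sub>0\<close>, without the markers\<close>
  sa_delta :: "('q \<times> 'a option \<times> 'g cell \<times> 'q \<times> 'g instr) set"
  sa_init :: 'q
  sa_finals :: "'q set"

definition cells :: "('q, 'a, 'g) sa \<Rightarrow> 'g cell set" where
  "cells M = {Bot, Top} \<union> Sym ` sa_syms M"

definition instrs :: "('q, 'a, 'g) sa \<Rightarrow> 'g instr set" where
  "instrs M = {Stay, Pop, Down, Hold, Up} \<union> Push ` sa_syms M"

definition stack_automaton :: "('q, 'a, 'g) sa \<Rightarrow> bool" where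
  "stack_automaton M \<longleftrightarrow>
     finite (sa_states M) \<and> finite (sa_inputs M) \<and> finite (sa_syms M) \<and>
     sa_init M \<in> sa_states M \<and> sa_finals M \<subseteq> sa_states M \<and>
     sa_delta M \<subseteq> sa_states M \<times> ({None} \<union> Some ` sa_inputs M) \<times> cells M \<times> sa_states M \<times> instrs M"

definition write_instr :: "'g instr \<Rightarrow> bool" where
  "write_instr \<iota> \<longleftrightarrow> \<iota> = Stay \<or> (\<exists>g. \<iota> = Push g) \<or> \<iota> = Pop"

definition read_instr :: "'g instr \<Rightarrow> bool" where
  "read_instr \<iota> \<longleftrightarrow> \<iota> \<in> {Down, Hold, Up}"

definition state_partition :: "('q, 'a, 'g) sa \<Rightarrow> 'q set \<Rightarrow> 'q set \<Rightarrow> bool" where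
  "state_partition M Qw Qr \<longleftrightarrow>
     sa_states M = Qw \<union> Qr \<and> Qw \<inter> Qr = {} \<and> sa_finals M \<subseteq> Qr \<and>
     (\<forall>(q, a, y, p, \<iota>) \<in> sa_delta M.
        (q \<in> Qw \<longrightarrow> write_instr \<iota>) \<and> (q \<in> Qr \<longrightarrow> read_instr \<iota>))"

definition non_erasing :: "('q, 'a, 'g) sa \<Rightarrow> bool" where
  "non_erasing M \<longleftrightarrow> (\<forall>(q, a, y, p, \<iota>) \<in> sa_delta M. \<iota> \<noteq> Pop)"

definition checking_stack_automaton :: "('q, 'a, 'g) sa \<Rightarrow> bool" where
  "checking_stack_automaton M \<longleftrightarrow>
     stack_automaton M \<and> non_erasing M \<and>
     (\<exists>Qw Qr. state_partition M Qw Qr \<and>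
        (\<forall>(q, a, y, p, \<iota>) \<in> sa_delta M. \<not> (q \<in> Qr \<and> p \<in> Qw)))"


section \<open>Computations\<close>

text \<open>
  In a configuration \<open>(q, w, l, r)\<close> the stack content is \<open>l @ r\<close>, listed from bottom to top,
  and the head scans the last symbol of \<open>l\<close>.
\<close>

type_synonym ('q, 'a, 'g) config = "'q \<times> 'a list \<times> 'g cell list \<times> 'g cell list"

definition stack_contents :: "('q, 'a, 'g) sa \<Rightarrow> 'g cell list set" where
  "stack_contents M = {Bot # map Sym s @ [Top] | s. s \<in> lists (sa_syms M)}"

fun word_of :: "'a option \<Rightarrow> 'a list" where
  "word_of None = []"
| "word_of (Some a) = [a]"

inductive write_step :: "('q, 'a, 'g) sa \<Rightarrow> ('q, 'a, 'g) config \<Rightarrow> ('q, 'a, 'g) config \<Rightarrow> bool"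
  for M where
  stay: "(q, a, x, p, Stay) \<in> sa_delta M \<Longrightarrow> x \<noteq> Top \<Longrightarrow> u \<in> lists (sa_inputs M)
    \<Longrightarrow> l @ [x, Top] \<in> stack_contents M
    \<Longrightarrow> write_step M (q, word_of a @ u, l @ [x], [Top]) (p, u, l @ [x], [Top])"
| push: "(q, a, x, p, Push y) \<in> sa_delta M \<Longrightarrow> x \<noteq> Top \<Longrightarrow> u \<in> lists (sa_inputs M)
    \<Longrightarrow> l @ [x, Top] \<in> stack_contents M
    \<Longrightarrow> write_step M (q, word_of a @ u, l @ [x], [Top]) (p, u, l @ [x, Sym y], [Top])"
| pop: "(q, a, x, p, Pop) \<in> sa_delta M \<Longrightarrow> x \<noteq> Top \<Longrightarrow> x \<noteq> Bot \<Longrightarrow> u \<in> lists (sa_inputs M)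
    \<Longrightarrow> l @ [x, Top] \<in> stack_contents M
    \<Longrightarrow> write_step M (q, word_of a @ u, l @ [x], [Top]) (p, u, l, [Top])"

inductive read_step :: "('q, 'a, 'g) sa \<Rightarrow> ('q, 'a, 'g) config \<Rightarrow> ('q, 'a, 'g) config \<Rightarrow> bool"
  for M where
  down: "(q, a, x, p, Down) \<in> sa_delta M \<Longrightarrow> x \<noteq> Bot \<Longrightarrow> u \<in> lists (sa_inputs M)
    \<Longrightarrow> l @ x # r \<in> stack_contents M
    \<Longrightarrow> read_step M (q, word_of a @ u, l @ [x], r) (p, u, l, x # r)"
| hold: "(q, a, x, p, Hold) \<in> sa_delta M \<Longrightarrow> u \<in> lists (sa_inputs M)
    \<Longrightarrow> l @ x # r \<in> stack_contents M
    \<Longrightarrow> read_step M (q, word_of a @ u, l @ [x], r) (p, u, l @ [x], r)"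
| up: "(q, a, x, p, Up) \<in> sa_delta M \<Longrightarrow> u \<in> lists (sa_inputs M)
    \<Longrightarrow> l @ x # y # r \<in> stack_contents M
    \<Longrightarrow> read_step M (q, word_of a @ u, l @ [x], y # r) (p, u, l @ [x, y], r)"

definition step :: "('q, 'a, 'g) sa \<Rightarrow> ('q, 'a, 'g) config \<Rightarrow> ('q, 'a, 'g) config \<Rightarrow> bool" where
  "step M c c' \<longleftrightarrow> write_step M c c' \<or> read_step M c c'"

definition partial_computation ::
    "('q, 'a, 'g) sa \<Rightarrow> 'a list \<Rightarrow> ('q, 'a, 'g) config list \<Rightarrow> bool" where
  "partial_computation M u cs \<longleftrightarrow>
     u \<in> lists (sa_inputs M) \<and> cs \<noteq> [] \<and> hd cs = (sa_init M, u, [Bot], [Top]) \<and>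
     successively (step M) cs"

definition computation ::
    "('q, 'a, 'g) sa \<Rightarrow> 'a list \<Rightarrow> ('q, 'a, 'g) config list \<Rightarrow> bool" where
  "computation M u cs \<longleftrightarrow> partial_computation M u cs \<and> fst (snd (last cs)) = []"

definition accepting_computation ::
    "('q, 'a, 'g) sa \<Rightarrow> 'a list \<Rightarrow> ('q, 'a, 'g) config list \<Rightarrow> bool" where
  "accepting_computation M u cs \<longleftrightarrow> computation M u cs \<and> fst (last cs) \<in> sa_finals M"

definition language :: "('q, 'a, 'g) sa \<Rightarrow> 'a list set" where
  "language M = {u \<in> lists (sa_inputs M). \<exists>cs. accepting_computation M u cs}"


section \<open>Weak space\<close>

text \<open>The two markers do not count towards the stack size.\<close>

fun stack_size :: "('q, 'a, 'g) config \<Rightarrow> nat" where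
  "stack_size (q, w, l, r) = length l + length r - 2"

definition computation_space :: "('q, 'a, 'g) config list \<Rightarrow> nat" where
  "computation_space cs = Max (stack_size ` set cs)"

definition weak_space_word :: "('q, 'a, 'g) sa \<Rightarrow> 'a list \<Rightarrow> nat" where
  "weak_space_word M u =
     (if u \<in> language M
      then (LEAST k. \<exists>cs. accepting_computation M u cs \<and> computation_space cs = k)
      else 0)"

text \<open>
  For a finite input alphabet this is a supremum over a finite set. The set is empty only if the
  alphabet is empty and \<open>n > 0\<close>; the value is then \<open>0\<close>.
\<close>

definition weak_space :: "('q, 'a, 'g) sa \<Rightarrow> nat \<Rightarrow> nat" where
  "weak_space M n = (SUP u \<in> {u \<in> lists (sa_inputs M). length u = n}. weak_space_word M u)"


section \<open>Finite descriptions of stack automata\<close>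

text \<open>
  A stack automaton whose states and symbols are named by natural numbers is a finite object,
  and is described by a single number. Up to renaming, every stack automaton is of this form.
\<close>

fun option_code :: "nat option \<Rightarrow> nat" where
  "option_code None = 0"
| "option_code (Some a) = Suc a"

fun cell_code :: "nat cell \<Rightarrow> nat" where
  "cell_code Bot = 0"
| "cell_code Top = 1"
| "cell_code (Sym g) = g + 2"

fun instr_code :: "nat instr \<Rightarrow> nat" where
  "instr_code Stay = 0"
| "instr_code Pop = 1"
| "instr_code Down = 2"
| "instr_code Hold = 3"
| "instr_code Up = 4"
| "instr_code (Push g) = g + 5"

fun transition_code :: "nat \<times> nat option \<times> nat cell \<times> nat \<times> nat instr \<Rightarrow> nat" where
  "transition_code (q, a, y, p, \<iota>) =
     list_encode [q, option_code a, cell_code y, p, instr_code \<iota>]"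

definition sa_code :: "(nat, nat, nat) sa \<Rightarrow> nat" where
  "sa_code M = list_encode
     [set_encode (sa_states M), set_encode (sa_inputs M), set_encode (sa_syms M),
      set_encode (transition_code ` sa_delta M), sa_init M, set_encode (sa_finals M)]"

lemma option_code_inject: "option_code a = option_code b \<Longrightarrow> a = b"
  by (cases a; cases b) auto

lemma cell_code_inject: "cell_code x = cell_code y \<Longrightarrow> x = y"
  by (cases x; cases y) auto

lemma instr_code_inject: "instr_code i = instr_code j \<Longrightarrow> i = j"
  by (cases i; cases j) auto

lemma inj_transition_code: "inj transition_code"
  by (rule injI) (auto dest: option_code_inject cell_code_inject instr_code_inject)

lemma finite_sa_delta:
  assumes "stack_automaton M"
  shows "finite (sa_delta M)"
proof (rule finite_subset)
  show "sa_delta M \<subseteq> sa_states M \<times> ({None} \<union> Some ` sa_inputs M) \<times> cells M \<times> sa_states M \<times> instrs M"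
    using assms by (simp add: stack_automaton_def)
  show "finite (sa_states M \<times> ({None} \<union> Some ` sa_inputs M) \<times> cells M \<times> sa_states M \<times> instrs M)"
    using assms by (auto simp: stack_automaton_def cells_def instrs_def)
qed

lemma inj_on_sa_code: "inj_on sa_code {M. stack_automaton M}"
proof (rule inj_onI)
  fix M N :: "(nat, nat, nat) sa"
  assume "M \<in> {M. stack_automaton M}" "N \<in> {M. stack_automaton M}" and eq: "sa_code M = sa_code N"
  then have M: "stack_automaton M" and N: "stack_automaton N" by simp_all
  have inj: "A = B" if "set_encode A = set_encode B" "finite A" "finite B" for A B
    using that set_encode_inverse by metis
  have fin: "finite (sa_finals M)" "finite (sa_finals N)"
    using M N by (auto simp: stack_automaton_def intro: finite_subset)
  have "transition_code ` sa_delta M = transition_code ` sa_delta N"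
    using eq finite_sa_delta[OF M] finite_sa_delta[OF N] by (intro inj) (auto simp: sa_code_def)
  then have "sa_delta M = sa_delta N"
    by (simp add: inj_image_eq_iff[OF inj_transition_code])
  moreover have "sa_states M = sa_states N" "sa_inputs M = sa_inputs N" "sa_syms M = sa_syms N"
    using eq M N by (simp_all add: sa_code_def stack_automaton_def inj)
  moreover have "sa_init M = sa_init N" "sa_finals M = sa_finals N"
    using eq fin by (simp_all add: sa_code_def inj)
  ultimately show "M = N"
    by (intro sa.equality) simp_all
qed

end

theory Submission
  imports Defs "HOL-Library.Countable"
begin

text \<open>
  Partial recursive functions are compiled to loop programs on registers. For a program and an input
  \<open>n\<close>, a checking stack automaton reads a purported history of the run and accepts if it
  finds an error: it guesses a number \<open>k\<close> on its stack, verifies that \<open>k\<close> is the value some register must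
  have in the next block, and accepts if that block disagrees. Its stack height is thus
  the correct value at some erroneous place. If the run halts, the first error always occurs within
  finitely many configurations, and the weak space is bounded; if it does not halt, correct histories
  whose only error is the last value of a clock register force an unbounded stack.

  Given a decision procedure, the diagonal program, started on its own number \<open>e\<close>, computes the code
  of the automaton for itself and \<open>e\<close>, runs the procedure on it, and halts iff the answer is
  ``unbounded''.
\<close>

section \<open>Compiling recursive functions to loop programs\<close>

text \<open>Once a checking stack automaton reads its stack it can no longer write, so besides its
  finite control it carries from one block to the next only what it guessed in advance. Guessing the
  value that ought to come next lets one number serve twice: counting upwards along the stack in one
  block confirms the guess, counting downwards in the following block refutes that block. Searching
  for errors instead of accepting correct histories suits the weak measure. Rejected words count as
  \<open>0\<close>, so a correct history costs nothing, and since the measure takes a minimum over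
  accepting computations, later errors cannot raise it above the correct value at the first error.
  Blocks after the program has halted are never examined: an empty control ends the search, and this
  confines the relevant errors to genuine configurations before or at the halt.\<close>

datatype delta = Inc | Same | Dec

datatype cmd = Asg nat nat delta | Loop nat "cmd list"

instance delta :: countable by countable_datatype
instance cmd :: countable by countable_datatype

fun apply_delta :: "delta \<Rightarrow> nat \<Rightarrow> nat" where
  "apply_delta Inc x = Suc x"
| "apply_delta Same x = x"
| "apply_delta Dec x = x - 1"

fun next_ctrl :: "cmd list \<Rightarrow> bool \<Rightarrow> cmd list" where
  "next_ctrl [] z = []"
| "next_ctrl (Asg r s d # K) z = K"
| "next_ctrl (Loop r c # K) z = (if z then c @ Loop r c # K else K)"

fun tests :: "cmd list \<Rightarrow> nat \<Rightarrow> bool" where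
  "tests (Loop r c # K) r' = (r' = r)"
| "tests _ r' = False"

text \<open>
  \<open>update K r = (s, d)\<close> says that one step from control \<open>K\<close> sets register \<open>r\<close> to
  register \<open>s\<close> changed by \<open>d\<close>. Register \<open>0\<close> is a clock, whatever the program does:
  it makes the register values of a diverging run unbounded.
\<close>

fun update :: "cmd list \<Rightarrow> nat \<Rightarrow> nat \<times> delta" where
  "update (Asg r s d # K) r' = (if r' = 0 then (0, Inc) else if r' = r then (s, d) else (r', Same))"
| "update _ r' = (if r' = 0 then (0, Inc) else (r', Same))"

definition new_value :: "cmd list \<Rightarrow> (nat \<Rightarrow> nat) \<Rightarrow> nat \<Rightarrow> nat" where
  "new_value K x r = apply_delta (snd (update K r)) (x (fst (update K r)))"

definition test_value :: "cmd list \<Rightarrow> (nat \<Rightarrow> nat) \<Rightarrow> bool" where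
  "test_value K x \<longleftrightarrow> (\<exists>r. tests K r \<and> x r \<noteq> 0)"

fun run_step :: "cmd list \<times> (nat \<Rightarrow> nat) \<Rightarrow> cmd list \<times> (nat \<Rightarrow> nat)" where
  "run_step (K, x) = (next_ctrl K (test_value K x), new_value K x)"

definition runs :: "cmd list \<times> (nat \<Rightarrow> nat) \<Rightarrow> cmd list \<times> (nat \<Rightarrow> nat) \<Rightarrow> bool" where
  "runs c d \<longleftrightarrow> (\<exists>t. (run_step ^^ t) c = d)"

lemma runs_refl: "runs c c"
  unfolding runs_def by (rule exI[of _ 0]) simp

lemma runs_trans: "runs a b \<Longrightarrow> runs b c \<Longrightarrow> runs a c"
proof -
  assume "runs a b" "runs b c"
  then obtain s t where "(run_step ^^ s) a = b" "(run_step ^^ t) b = c" unfolding runs_def by blast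
  then have "(run_step ^^ (t + s)) a = c" by (simp add: funpow_add)
  then show "runs a c" unfolding runs_def by blast
qed

lemma runs_step: "run_step c = d \<Longrightarrow> runs c d"
  unfolding runs_def by (rule exI[of _ 1]) simp

lemma runs_Asg:
  assumes "0 < r"
  shows "\<exists>y. runs (Asg r s d # K, x) (K, y) \<and> y r = apply_delta d (x s) \<and>
    (\<forall>j. 0 < j \<and> j \<noteq> r \<longrightarrow> y j = x j)"
  using assms
  by (intro exI[of _ "new_value (Asg r s d # K) x"] conjI runs_step)
    (simp_all add: new_value_def)

lemma runs_Loop_0:
  assumes "x r = 0"
  shows "\<exists>y. runs (Loop r c # K, x) (K, y) \<and> (\<forall>j. 0 < j \<longrightarrow> y j = x j)"
  using assms
  by (intro exI[of _ "new_value (Loop r c # K) x"] conjI runs_step)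
    (simp_all add: new_value_def test_value_def)

lemma runs_Loop_pos:
  assumes "x r \<noteq> 0"
  shows "\<exists>y. runs (Loop r c # K, x) (c @ Loop r c # K, y) \<and> (\<forall>j. 0 < j \<longrightarrow> y j = x j)"
  using assms
  by (intro exI[of _ "new_value (Loop r c # K) x"] conjI runs_step)
    (simp_all add: new_value_def test_value_def)

definition clear :: "nat \<Rightarrow> cmd" where
  "clear r = Loop r [Asg r r Dec]"

lemma runs_clear:
  assumes "0 < r"
  shows "\<exists>y. runs (clear r # K, x) (K, y) \<and> y r = 0 \<and> (\<forall>j. 0 < j \<and> j \<noteq> r \<longrightarrow> y j = x j)"
proof (induction "x r" arbitrary: x)
  case 0
  with runs_Loop_0[of x r "[Asg r r Dec]" K] assms show ?case unfolding clear_def by auto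
next
  case (Suc v)
  from runs_Loop_pos[of x r "[Asg r r Dec]" K] Suc(2) assms obtain y where
    y: "runs (clear r # K, x) (Asg r r Dec # clear r # K, y)" "\<forall>j. 0 < j \<longrightarrow> y j = x j"
    unfolding clear_def by auto
  from runs_Asg[OF assms, of r Dec "clear r # K" y] obtain z where
    z: "runs (Asg r r Dec # clear r # K, y) (clear r # K, z)" "z r = y r - 1"
       "\<forall>j. 0 < j \<and> j \<noteq> r \<longrightarrow> z j = y j" by auto
  have "v = z r" using Suc(2) z(2) y(2) assms by simp
  from Suc(1)[of z, OF this] obtain w where "runs (clear r # K, z) (K, w)" "w r = 0"
    "\<forall>j. 0 < j \<and> j \<noteq> r \<longrightarrow> w j = z j" by blast
  with y(2) z(2,3) runs_trans[OF runs_trans[OF y(1) z(1)]] show ?case by (intro exI[of _ w]) auto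
qed

text \<open>
  The compiled code reads its arguments from the registers \<open>ins\<close>, leaves the result in \<open>out\<close>, and
  may destroy every register from \<open>fr\<close> on. Only terminating evaluations have to be simulated
  correctly, since the diagonal program adds its own infinite loop.
\<close>

fun compile :: "recf \<Rightarrow> nat list \<Rightarrow> nat \<Rightarrow> nat \<Rightarrow> cmd list"
and compile_list :: "recf list \<Rightarrow> nat list \<Rightarrow> nat \<Rightarrow> nat \<Rightarrow> cmd list" where
  "compile Zero ins out fr = [clear out]"
| "compile Succ ins out fr = [Asg out (ins ! 0) Inc]"
| "compile (Proj i) ins out fr = [Asg out (ins ! i) Same]"
| "compile (Comp f gs) ins out fr =
     compile_list gs ins fr (fr + length gs) @
     compile f [fr..<fr + length gs] out (fr + length gs)"
| "compile (PrimRec f g) ins out fr =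
     compile f (tl ins) fr (fr + 4) @ clear (fr + 1) # Asg (fr + 2) (hd ins) Same #
     Loop (fr + 2)
       (compile g ((fr + 1) # fr # tl ins) (fr + 3) (fr + 4) @
        [Asg fr (fr + 3) Same, Asg (fr + 1) (fr + 1) Inc, Asg (fr + 2) (fr + 2) Dec]) #
     [Asg out fr Same]"
| "compile (Mu f) ins out fr =
     clear fr # compile f (fr # ins) (fr + 1) (fr + 2) @
     Loop (fr + 1) (Asg fr fr Inc # compile f (fr # ins) (fr + 1) (fr + 2)) #
     [Asg out fr Same]"
| "compile_list [] ins out fr = []"
| "compile_list (g # gs) ins out fr = compile g ins out fr @ compile_list gs ins (Suc out) fr"

text \<open>Quantifying over the continuation \<open>K\<close> turns sequential composition into
  transitivity of \<open>runs\<close>. Nothing is promised about register \<open>0\<close>, because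
  the clock advances in every step.\<close>

definition compiled :: "recf \<Rightarrow> bool" where
  "compiled f \<longleftrightarrow> (\<forall>ins out fr x y K.
     computes f (map x ins) y \<longrightarrow> (\<forall>i\<in>set ins. 0 < i \<and> i < fr) \<longrightarrow> 0 < out \<longrightarrow> out < fr \<longrightarrow>
     out \<notin> set ins \<longrightarrow>
     (\<exists>x'. runs (compile f ins out fr @ K, x) (K, x') \<and> x' out = y \<and>
        (\<forall>j. 0 < j \<and> j < fr \<and> j \<noteq> out \<longrightarrow> x' j = x j)))"

lemma compiledD:
  assumes "compiled f" "computes f xs y" "xs = map x ins" "\<forall>i\<in>set ins. 0 < i \<and> i < fr"
    "0 < out" "out < fr" "out \<notin> set ins"
  obtains x' where "runs (compile f ins out fr @ K, x) (K, x')" "x' out = y"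
    "\<And>j. 0 < j \<Longrightarrow> j < fr \<Longrightarrow> j \<noteq> out \<Longrightarrow> x' j = x j"
proof -
  have "\<exists>x'. runs (compile f ins out fr @ K, x) (K, x') \<and> x' out = y \<and>
      (\<forall>j. 0 < j \<and> j < fr \<and> j \<noteq> out \<longrightarrow> x' j = x j)"
    using assms(1)[unfolded compiled_def, rule_format, of x ins y fr out K] assms(2-) by simp
  with that show thesis by blast
qed

text \<open>All calls share the scratch area from \<open>fr\<close> on. It lies above the whole
  block of results, and the inputs lie below it, so later calls destroy neither earlier results nor
  inputs.\<close>

lemma compile_list_runs:
  assumes "\<And>g. g \<in> set gs \<Longrightarrow> compiled g" "list_all2 (\<lambda>g y. computes g (map x ins) y) gs ys"
    "\<forall>i\<in>set ins. 0 < i \<and> i < out" "0 < out" "out + length gs \<le> fr"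
  shows "\<exists>x'. runs (compile_list gs ins out fr @ K, x) (K, x') \<and>
     map x' [out..<out + length gs] = ys \<and> (\<forall>j. 0 < j \<and> j < out \<longrightarrow> x' j = x j)"
  using assms
proof (induction gs arbitrary: ys x out)
  case Nil
  then show ?case by (auto intro: runs_refl)
next
  case (Cons g gs)
  from Cons.prems(2) obtain y ys' where ys: "ys = y # ys'" and y: "computes g (map x ins) y"
    and ys': "list_all2 (\<lambda>g y. computes g (map x ins) y) gs ys'"
    by (auto simp: list_all2_Cons1)
  have ins: "\<forall>i\<in>set ins. 0 < i \<and> i < fr" "out \<notin> set ins" using Cons.prems(3,5) by auto
  have "compiled g" using Cons.prems(1) by simp
  from compiledD[OF this y refl ins(1) Cons.prems(4) _ ins(2), of "compile_list gs ins (Suc out) fr @ K"]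
    Cons.prems(5)
  obtain x1 where x1: "runs (compile g ins out fr @ compile_list gs ins (Suc out) fr @ K, x)
       (compile_list gs ins (Suc out) fr @ K, x1)" "x1 out = y"
    "\<And>j. 0 < j \<Longrightarrow> j < fr \<Longrightarrow> j \<noteq> out \<Longrightarrow> x1 j = x j" by auto
  have eq: "map x1 ins = map x ins" using x1(3) ins by (intro map_cong) auto
  have "\<exists>x'. runs (compile_list gs ins (Suc out) fr @ K, x1) (K, x') \<and>
     map x' [Suc out..<Suc out + length gs] = ys' \<and> (\<forall>j. 0 < j \<and> j < Suc out \<longrightarrow> x' j = x1 j)"
    by (rule Cons.IH) (use Cons.prems ys' in \<open>auto simp: eq less_Suc_eq\<close>)
  then obtain x2 where x2: "runs (compile_list gs ins (Suc out) fr @ K, x1) (K, x2)"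
     "map x2 [Suc out..<Suc out + length gs] = ys'" "\<forall>j. 0 < j \<and> j < Suc out \<longrightarrow> x2 j = x1 j" by blast
  have "runs (compile_list (g # gs) ins out fr @ K, x) (K, x2)"
    using runs_trans[OF x1(1) x2(1)] by simp
  moreover have "map x2 [out..<out + length (g # gs)] = ys"
  proof -
    have "[out..<out + length (g # gs)] = out # [Suc out..<Suc out + length gs]"
      by (subst upt_conv_Cons) auto
    then show ?thesis using x2(2,3) x1(2) Cons.prems(4) ys by simp
  qed
  moreover have "\<forall>j. 0 < j \<and> j < out \<longrightarrow> x2 j = x j"
    using x2(3) x1(3) Cons.prems(5) by simp
  ultimately show ?case by blast
qed

lemma computes_PrimRecE:
  assumes "computes (PrimRec f g) (n # xs) y"
  obtains Y where "computes f xs (Y 0)" "\<And>i. i < n \<Longrightarrow> computes g (i # Y i # xs) (Y (Suc i))" "Y n = y"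
  using assms
proof (induction n arbitrary: y thesis)
  case 0
  from 0(2) have "computes f xs y" by (rule computes_elims(5))
  then show ?case by (intro 0(1)[of "\<lambda>_. y"]) auto
next
  case (Suc n)
  from Suc.prems(2) obtain y' where y': "computes (PrimRec f g) (n # xs) y'" "computes g (n # y' # xs) y"
    by (rule computes_elims(6))
  obtain Y where "computes f xs (Y 0)" "\<And>i. i < n \<Longrightarrow> computes g (i # Y i # xs) (Y (Suc i))" "Y n = y'"
    using Suc.IH[OF _ y'(1)] by blast
  with y'(2) show ?case by (intro Suc.prems(1)[of "Y(Suc n := y)"]) (auto simp: less_Suc_eq)
qed

text \<open>Register layout: \<open>fr\<close> holds the current value, \<open>fr + 1\<close> the
  recursion index, \<open>fr + 2\<close> the number of iterations left. The code for
  \<open>g\<close> reads \<open>fr\<close>, so its result goes to \<open>fr + 3\<close> and is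
  copied back.\<close>

lemma compiled_PrimRec:
  assumes f: "compiled f" and g: "compiled g"
  shows "compiled (PrimRec f g)"
  unfolding compiled_def
proof (intro allI impI)
  fix ins :: "nat list" and out fr y :: nat and x K
  assume c: "computes (PrimRec f g) (map x ins) y" and ins: "\<forall>i\<in>set ins. 0 < i \<and> i < fr"
    and out: "0 < out" "out < fr" "out \<notin> set ins"
  from c obtain i0 js where ins': "ins = i0 # js"
    by (cases ins) (auto elim: computes.cases)
  from c obtain Y where Y0: "computes f (map x js) (Y 0)"
    and YS: "\<And>i. i < x i0 \<Longrightarrow> computes g (i # Y i # map x js) (Y (Suc i))" and Yn: "Y (x i0) = y"
    unfolding ins' list.map by (rule computes_PrimRecE) blast
  define c3 where "c3 = [Asg out fr Same] @ K"
  define body where "body = compile g ((fr + 1) # fr # js) (fr + 3) (fr + 4) @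
        [Asg fr (fr + 3) Same, Asg (fr + 1) (fr + 1) Inc, Asg (fr + 2) (fr + 2) Dec]"
  define c2 where "c2 = Loop (fr + 2) body # c3"
  define c1 where "c1 = clear (fr + 1) # Asg (fr + 2) i0 Same # c2"
  have eq: "compile (PrimRec f g) ins out fr @ K = compile f js fr (fr + 4) @ c1"
    by (simp add: c1_def c2_def c3_def body_def ins')
  have pos: "0 < i" "i < fr" if "i \<in> set ins" for i using ins that by auto
  \<comment> \<open>Loop invariant, by induction on the iterations left: index plus remaining
    iterations is always the original argument \<open>x i0\<close>.\<close>
  have loop: "\<exists>w. runs (c2, v) (c3, w) \<and> w fr = y \<and> (\<forall>j. 0 < j \<and> j < fr \<longrightarrow> w j = x j)"
    if "v (fr + 2) = d" "v (fr + 1) + d = x i0" "v fr = Y (v (fr + 1))" "\<forall>j. 0 < j \<and> j < fr \<longrightarrow> v j = x j"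
    for v d
    using that
  proof (induction d arbitrary: v)
    case 0
    from runs_Loop_0[of v "fr + 2" body c3] 0(1) obtain w where
      "runs (c2, v) (c3, w)" "\<forall>j. 0 < j \<longrightarrow> w j = v j" unfolding c2_def by auto
    with 0 Yn out show ?case by (intro exI[of _ w]) auto
  next
    case (Suc d)
    from runs_Loop_pos[of v "fr + 2" body c3] Suc(2) obtain v1 where
      v1: "runs (c2, v) (body @ c2, v1)" "\<forall>j. 0 < j \<longrightarrow> v1 j = v j" unfolding c2_def by auto
    let ?i = "v (fr + 1)"
    let ?K2 = "Asg (fr + 2) (fr + 2) Dec # c2"
    let ?K1 = "Asg (fr + 1) (fr + 1) Inc # ?K2"
    let ?K0 = "Asg fr (fr + 3) Same # ?K1"
    let ?ins = "(fr + 1) # fr # js"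
    have c: "computes g (?i # Y ?i # map x js) (Y (Suc ?i))" using Suc(3) by (intro YS) simp
    have e: "?i # Y ?i # map x js = map v1 ?ins"
      using Suc(4,5) v1(2) pos out by (auto simp: ins')
    have b: "\<forall>i\<in>set ?ins. 0 < i \<and> i < fr + 4" using pos out ins' by force
    have n: "fr + 3 \<notin> set ?ins" using pos ins' by force
    obtain v2 where v2:
      "runs (compile g ?ins (fr + 3) (fr + 4) @ ?K0, v1) (?K0, v2)"
      "v2 (fr + 3) = Y (Suc ?i)" "\<And>j. 0 < j \<Longrightarrow> j < fr + 4 \<Longrightarrow> j \<noteq> fr + 3 \<Longrightarrow> v2 j = v1 j"
      by (rule compiledD[OF g c e b _ _ n, of ?K0]) auto
    from runs_Asg[of fr "fr + 3" Same ?K1 v2] out obtain v3 where v3: "runs (?K0, v2) (?K1, v3)"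
      "v3 fr = v2 (fr + 3)" "\<forall>j. 0 < j \<and> j \<noteq> fr \<longrightarrow> v3 j = v2 j" by auto
    from runs_Asg[of "fr + 1" "fr + 1" Inc ?K2 v3] obtain v4 where v4: "runs (?K1, v3) (?K2, v4)"
      "v4 (fr + 1) = Suc (v3 (fr + 1))" "\<forall>j. 0 < j \<and> j \<noteq> fr + 1 \<longrightarrow> v4 j = v3 j" by auto
    from runs_Asg[of "fr + 2" "fr + 2" Dec c2 v4] obtain v5 where v5: "runs (?K2, v4) (c2, v5)"
      "v5 (fr + 2) = v4 (fr + 2) - 1" "\<forall>j. 0 < j \<and> j \<noteq> fr + 2 \<longrightarrow> v5 j = v4 j" by auto
    have vs: "v5 (fr + 2) = d" "v5 (fr + 1) = Suc ?i" "v5 fr = Y (Suc ?i)"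
      using v5 v4 v3 v2(2) v2(3)[of "fr + 1"] v2(3)[of "fr + 2"] v1(2) out Suc(2) by auto
    have small: "\<forall>j. 0 < j \<and> j < fr \<longrightarrow> v5 j = x j"
      using v5(3) v4(3) v3(3) v2(3) v1(2) Suc(5) by auto
    obtain w where w: "runs (c2, v5) (c3, w)" "w fr = y" "\<forall>j. 0 < j \<and> j < fr \<longrightarrow> w j = x j"
      using Suc(1)[of v5] vs small Suc(3) by auto
    have "runs (body @ c2, v1) (c2, v5)"
      using runs_trans[OF runs_trans[OF runs_trans[OF v2(1) v3(1)] v4(1)] v5(1)] by (simp add: body_def)
    with runs_trans[OF runs_trans[OF v1(1)]] w show ?case by (intro exI[of _ w]) auto
  qed
  have "map x js = map x js" "\<forall>i\<in>set js. 0 < i \<and> i < fr + 4" "0 < fr" "fr \<notin> set js"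
    using pos out ins' by force+
  with compiledD[OF f Y0, of x js "fr + 4" fr c1]
  obtain x1 where x1: "runs (compile f js fr (fr + 4) @ c1, x) (c1, x1)" "x1 fr = Y 0"
    "\<And>j. 0 < j \<Longrightarrow> j < fr + 4 \<Longrightarrow> j \<noteq> fr \<Longrightarrow> x1 j = x j" by auto
  from runs_clear[of "fr + 1" "Asg (fr + 2) i0 Same # c2" x1] obtain x2 where
    x2: "runs (c1, x1) (Asg (fr + 2) i0 Same # c2, x2)" "x2 (fr + 1) = 0"
      "\<forall>j. 0 < j \<and> j \<noteq> fr + 1 \<longrightarrow> x2 j = x1 j" unfolding c1_def by auto
  from runs_Asg[of "fr + 2" i0 Same c2 x2] obtain x3 where
    x3: "runs (Asg (fr + 2) i0 Same # c2, x2) (c2, x3)" "x3 (fr + 2) = x2 i0"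
      "\<forall>j. 0 < j \<and> j \<noteq> fr + 2 \<longrightarrow> x3 j = x2 j" by auto
  have i0: "0 < i0" "i0 < fr" using pos ins' by auto
  have a: "x3 (fr + 2) = x i0" using x3(2) x2(3) x1(3)[of i0] i0 by simp
  have b: "x3 (fr + 1) = 0" "x3 fr = Y 0" using x3(3) x2 x1(2) out by auto
  have c: "\<forall>j. 0 < j \<and> j < fr \<longrightarrow> x3 j = x j" using x3(3) x2(3) x1(3) by auto
  obtain x4 where x4: "runs (c2, x3) (c3, x4)" "x4 fr = y" "\<forall>j. 0 < j \<and> j < fr \<longrightarrow> x4 j = x j"
    using loop[of x3 "x i0"] a b c by auto
  from runs_Asg[of out fr Same K x4] out obtain x5 where
    x5: "runs (c3, x4) (K, x5)" "x5 out = y" "\<forall>j. 0 < j \<and> j \<noteq> out \<longrightarrow> x5 j = x4 j"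
    unfolding c3_def using x4(2) by auto
  have "runs (compile (PrimRec f g) ins out fr @ K, x) (K, x5)"
    unfolding eq using runs_trans[OF runs_trans[OF runs_trans[OF runs_trans[OF x1(1) x2(1)] x3(1)] x4(1)] x5(1)] .
  with x5 x4(3) show "\<exists>x'. runs (compile (PrimRec f g) ins out fr @ K, x) (K, x') \<and> x' out = y \<and>
      (\<forall>j. 0 < j \<and> j < fr \<and> j \<noteq> out \<longrightarrow> x' j = x j)" by auto
qed

lemma compiled_Mu:
  assumes f: "compiled f"
  shows "compiled (Mu f)"
  unfolding compiled_def
proof (intro allI impI)
  fix ins :: "nat list" and out fr y :: nat and x K
  assume c: "computes (Mu f) (map x ins) y" and ins: "\<forall>i\<in>set ins. 0 < i \<and> i < fr"
    and out: "0 < out" "out < fr" "out \<notin> set ins"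
  from c have y: "computes f (y # map x ins) 0" and less: "\<And>i. i < y \<Longrightarrow> \<exists>k. computes f (i # map x ins) (Suc k)"
    by (auto elim: computes_elims(7))
  define c3 where "c3 = [Asg out fr Same] @ K"
  let ?c = "compile f (fr # ins) (fr + 1) (fr + 2)"
  define c2 where "c2 = Loop (fr + 1) (Asg fr fr Inc # ?c) # c3"
  have ins2: "\<forall>i\<in>set (fr # ins). 0 < i \<and> i < fr + 2" "fr + 1 \<notin> set (fr # ins)"
    using ins out by force+
  \<comment> \<open>The invariant is placed at the evaluation of \<open>f\<close> rather than at the
    loop test: \<open>?c\<close> occurs before the loop and at the end of its body, so
    \<open>?c @ c2\<close> recurs. Here \<open>d\<close> is the distance to the least zero.\<close>
  have loop: "\<exists>w. runs (?c @ c2, v) (c3, w) \<and> w fr = y \<and> (\<forall>j. 0 < j \<and> j < fr \<longrightarrow> w j = x j)"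
    if "v fr + d = y" "\<forall>j. 0 < j \<and> j < fr \<longrightarrow> v j = x j" for v d
    using that
  proof (induction d arbitrary: v)
    case 0
    have "computes f (map v (fr # ins)) 0" using y 0 ins by (simp cong: map_cong)
    from compiledD[OF f this refl ins2(1) _ _ ins2(2), of c2]
    obtain v1 where v1: "runs (?c @ c2, v) (c2, v1)" "v1 (fr + 1) = 0"
      "\<And>j. 0 < j \<Longrightarrow> j < fr + 2 \<Longrightarrow> j \<noteq> fr + 1 \<Longrightarrow> v1 j = v j" by auto
    from runs_Loop_0[of v1 "fr + 1" _ c3] v1(2) obtain w where
      "runs (c2, v1) (c3, w)" "\<forall>j. 0 < j \<longrightarrow> w j = v1 j" unfolding c2_def by blast
    with v1 0 out runs_trans[OF v1(1)] show ?case by (intro exI[of _ w] conjI) auto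
  next
    case (Suc d)
    from less[of "v fr"] Suc(2) obtain k where "computes f (v fr # map x ins) (Suc k)" by auto
    then have "computes f (map v (fr # ins)) (Suc k)" using Suc(3) ins by (simp cong: map_cong)
    from compiledD[OF f this refl ins2(1) _ _ ins2(2), of c2]
    obtain v1 where v1: "runs (?c @ c2, v) (c2, v1)" "v1 (fr + 1) = Suc k"
      "\<And>j. 0 < j \<Longrightarrow> j < fr + 2 \<Longrightarrow> j \<noteq> fr + 1 \<Longrightarrow> v1 j = v j" by auto
    from runs_Loop_pos[of v1 "fr + 1" "Asg fr fr Inc # ?c" c3] v1(2) obtain v2 where
      v2: "runs (c2, v1) (Asg fr fr Inc # ?c @ c2, v2)" "\<forall>j. 0 < j \<longrightarrow> v2 j = v1 j"
      unfolding c2_def by auto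
    from runs_Asg[of fr fr Inc "?c @ c2" v2] out obtain v3 where
      v3: "runs (Asg fr fr Inc # ?c @ c2, v2) (?c @ c2, v3)" "v3 fr = Suc (v2 fr)"
        "\<forall>j. 0 < j \<and> j \<noteq> fr \<longrightarrow> v3 j = v2 j" by auto
    have "v3 fr + d = y" "\<forall>j. 0 < j \<and> j < fr \<longrightarrow> v3 j = x j"
      using v3 v2(2) v1(3) Suc(2,3) out by auto
    from Suc(1)[OF this] obtain w where "runs (?c @ c2, v3) (c3, w)" "w fr = y"
      "\<forall>j. 0 < j \<and> j < fr \<longrightarrow> w j = x j" by blast
    with runs_trans[OF runs_trans[OF runs_trans[OF v1(1) v2(1)] v3(1)]] show ?case
      by (intro exI[of _ w]) auto
  qed
  from runs_clear[of fr "?c @ c2" x] out obtain x1 where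
    x1: "runs (clear fr # ?c @ c2, x) (?c @ c2, x1)" "x1 fr = 0" "\<forall>j. 0 < j \<and> j \<noteq> fr \<longrightarrow> x1 j = x j"
    by auto
  from loop[of x1 y] x1 obtain x2 where
    x2: "runs (?c @ c2, x1) (c3, x2)" "x2 fr = y" "\<forall>j. 0 < j \<and> j < fr \<longrightarrow> x2 j = x j" by auto
  from runs_Asg[of out fr Same K x2] out obtain x3 where
    x3: "runs (c3, x2) (K, x3)" "x3 out = y" "\<forall>j. 0 < j \<and> j \<noteq> out \<longrightarrow> x3 j = x2 j"
    unfolding c3_def using x2(2) by auto
  have "runs (compile (Mu f) ins out fr @ K, x) (K, x3)"
    using runs_trans[OF runs_trans[OF x1(1) x2(1)] x3(1)] by (simp add: c2_def c3_def)
  with x3 x2(3) show "\<exists>x'. runs (compile (Mu f) ins out fr @ K, x) (K, x') \<and> x' out = y \<and>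
      (\<forall>j. 0 < j \<and> j < fr \<and> j \<noteq> out \<longrightarrow> x' j = x j)" by auto
qed

lemma compiled_Comp:
  assumes f: "compiled f" and gs: "\<And>g. g \<in> set gs \<Longrightarrow> compiled g"
  shows "compiled (Comp f gs)"
  unfolding compiled_def
proof (intro allI impI)
  fix ins :: "nat list" and out fr y :: nat and x K
  assume c: "computes (Comp f gs) (map x ins) y" and ins: "\<forall>i\<in>set ins. 0 < i \<and> i < fr"
    and out: "0 < out" "out < fr" "out \<notin> set ins"
  from c obtain ys where ys: "list_all2 (\<lambda>g y. computes g (map x ins) y) gs ys" "computes f ys y"
    by (rule computes_elims(4))
  let ?fr = "fr + length gs"
  let ?K = "compile f [fr..<?fr] out ?fr @ K"
  from compile_list_runs[OF gs ys(1) ins, of ?fr ?K] out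
  obtain x1 where x1: "runs (compile_list gs ins fr ?fr @ ?K, x) (?K, x1)"
    "map x1 [fr..<?fr] = ys" "\<forall>j. 0 < j \<and> j < fr \<longrightarrow> x1 j = x j" by auto
  from compiledD[OF f ys(2) x1(2)[symmetric], of ?fr out K] out
  obtain x2 where "runs (?K, x1) (K, x2)" "x2 out = y"
    "\<And>j. 0 < j \<Longrightarrow> j < ?fr \<Longrightarrow> j \<noteq> out \<Longrightarrow> x2 j = x1 j" by auto
  with x1 show "\<exists>x'. runs (compile (Comp f gs) ins out fr @ K, x) (K, x') \<and> x' out = y \<and>
      (\<forall>j. 0 < j \<and> j < fr \<and> j \<noteq> out \<longrightarrow> x' j = x j)"
    using runs_trans[OF x1(1)] by (intro exI[of _ x2]) auto
qed

lemma compiled: "compiled f"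
proof (induction f)
  case Zero
  show ?case unfolding compiled_def
  proof (intro allI impI)
    fix ins :: "nat list" and out fr y :: nat and x K
    assume "computes Zero (map x ins) y" "0 < out"
    then show "\<exists>x'. runs (compile Zero ins out fr @ K, x) (K, x') \<and> x' out = y \<and>
      (\<forall>j. 0 < j \<and> j < fr \<and> j \<noteq> out \<longrightarrow> x' j = x j)"
      using runs_clear[of out K x] by (auto elim!: computes_elims(1))
  qed
next
  case Succ
  show ?case unfolding compiled_def
  proof (intro allI impI)
    fix ins :: "nat list" and out fr y :: nat and x K
    assume "computes Succ (map x ins) y" "0 < out"
    then show "\<exists>x'. runs (compile Succ ins out fr @ K, x) (K, x') \<and> x' out = y \<and>
      (\<forall>j. 0 < j \<and> j < fr \<and> j \<noteq> out \<longrightarrow> x' j = x j)"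
      using runs_Asg[of out "ins ! 0" Inc K x] by (auto elim!: computes_elims(2))
  qed
next
  case (Proj i)
  show ?case unfolding compiled_def
  proof (intro allI impI)
    fix ins :: "nat list" and out fr y :: nat and x K
    assume "computes (Proj i) (map x ins) y" "0 < out"
    then show "\<exists>x'. runs (compile (Proj i) ins out fr @ K, x) (K, x') \<and> x' out = y \<and>
      (\<forall>j. 0 < j \<and> j < fr \<and> j \<noteq> out \<longrightarrow> x' j = x j)"
      using runs_Asg[of out "ins ! i" Same K x] by (auto elim!: computes_elims(3))
  qed
next
  case (Comp f gs)
  then show ?case by (intro compiled_Comp) auto
qed (intro compiled_PrimRec compiled_Mu; assumption)+

section \<open>Computable codes\<close>

definition recursive :: "nat \<Rightarrow> (nat list \<Rightarrow> nat) \<Rightarrow> bool" where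
  "recursive n f \<longleftrightarrow> (\<exists>r. \<forall>xs. length xs = n \<longrightarrow> computes r xs (f xs))"

lemma recursive_Suc: "recursive 1 (\<lambda>xs. Suc (xs ! 0))"
  unfolding recursive_def by (rule exI[of _ Succ]) (auto simp: length_Suc_conv intro: computes.intros)

lemma recursive_proj: "i < n \<Longrightarrow> recursive n (\<lambda>xs. xs ! i)"
  unfolding recursive_def by (rule exI[of _ "Proj i"]) (auto intro: computes.intros)

lemma recursive_comp1:
  assumes "recursive 1 f" "recursive n g"
  shows "recursive n (\<lambda>xs. f [g xs])"
proof -
  obtain r s where "\<And>xs. length xs = 1 \<Longrightarrow> computes r xs (f xs)" "\<And>xs. length xs = n \<Longrightarrow> computes s xs (g xs)"
    using assms unfolding recursive_def by blast
  then show ?thesis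
    unfolding recursive_def by (intro exI[of _ "Comp r [s]"]) (auto intro!: computes.comp)
qed

lemma recursive_comp2:
  assumes "recursive 2 f" "recursive n g" "recursive n h"
  shows "recursive n (\<lambda>xs. f [g xs, h xs])"
proof -
  obtain r s t where "\<And>xs. length xs = 2 \<Longrightarrow> computes r xs (f xs)" "\<And>xs. length xs = n \<Longrightarrow> computes s xs (g xs)"
    "\<And>xs. length xs = n \<Longrightarrow> computes t xs (h xs)"
    using assms unfolding recursive_def by blast
  then show ?thesis
    unfolding recursive_def
    by (intro exI[of _ "Comp r [s, t]"]) (auto intro!: computes.comp[where ys = "[_, _]"])
qed

lemma recursive_const: "recursive n (\<lambda>_. c)"
proof (induction c)
  case 0
  show ?case unfolding recursive_def by (rule exI[of _ Zero]) (auto intro: computes.intros)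
next
  case (Suc c)
  from recursive_comp1[OF recursive_Suc this] show ?case by simp
qed

lemma recursive_primrec:
  assumes "recursive n f" "recursive (Suc (Suc n)) g"
    and "\<And>xs. h (0 # xs) = f xs" "\<And>k xs. h (Suc k # xs) = g (k # h (k # xs) # xs)"
  shows "recursive (Suc n) h"
proof -
  obtain r s where r: "\<And>xs. length xs = n \<Longrightarrow> computes r xs (f xs)"
    and s: "\<And>xs. length xs = Suc (Suc n) \<Longrightarrow> computes s xs (g xs)"
    using assms(1,2) unfolding recursive_def by blast
  have "computes (PrimRec r s) (k # xs) (h (k # xs))" if "length xs = n" for k xs
  proof (induction k)
    case 0
    show ?case using r that by (auto simp: assms(3) intro: computes.intros)
  next
    case (Suc k)
    then show ?case using s that by (auto simp: assms(4) intro: computes.intros)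
  qed
  then show ?thesis
    unfolding recursive_def by (intro exI[of _ "PrimRec r s"]) (auto simp: length_Suc_conv)
qed

lemma recursive_add:
  assumes "recursive n f" "recursive n g"
  shows "recursive n (\<lambda>xs. f xs + g xs)"
proof -
  have "recursive (Suc 1) (\<lambda>xs. xs ! 0 + xs ! 1)"
    by (rule recursive_primrec[OF recursive_proj[of 0]
        recursive_comp1[OF recursive_Suc recursive_proj[of 1]]]) auto
  from recursive_comp2[OF this[unfolded Suc_1] assms] show ?thesis by simp
qed

lemma computes_map_Proj:
  "\<forall>i\<in>set js. i < length xs \<Longrightarrow> list_all2 (\<lambda>g. computes g xs) (map Proj js) (map ((!) xs) js)"
  by (induction js) (auto intro: computes.proj)

lemma recursive_sum:
  assumes "recursive n b" "recursive (Suc n) f"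
  shows "recursive n (\<lambda>xs. \<Sum>i<b xs. f (i # xs))"
proof -
  obtain r where r: "\<And>xs. length xs = Suc n \<Longrightarrow> computes r xs (f xs)"
    using assms unfolding recursive_def by blast
  \<comment> \<open>The step function of the recursion also receives the partial sum, as its second
    argument; it is projected away before \<open>f\<close> is applied.\<close>
  have f': "recursive (Suc (Suc n)) (\<lambda>xs. f (xs ! 0 # tl (tl xs)))"
    unfolding recursive_def
  proof (intro exI allI impI)
    fix xs :: "nat list" assume l: "length xs = Suc (Suc n)"
    have "xs ! 0 # tl (tl xs) = map ((!) xs) (0 # [2..<Suc (Suc n)])"
      using l by (intro nth_equalityI) (auto simp: nth_Cons nth_tl simp del: upt_Suc split: nat.splits)
    moreover have "list_all2 (\<lambda>g. computes g xs) (map Proj (0 # [2..<Suc (Suc n)]))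
        (map ((!) xs) (0 # [2..<Suc (Suc n)]))"
      using l by (intro computes_map_Proj) auto
    moreover have "computes r (xs ! 0 # tl (tl xs)) (f (xs ! 0 # tl (tl xs)))" using l by (intro r) simp
    ultimately show "computes (Comp r (map Proj (0 # [2..<Suc (Suc n)]))) xs (f (xs ! 0 # tl (tl xs)))"
      by (metis computes.comp)
  qed
  have "recursive (Suc n) (\<lambda>xs. \<Sum>i<hd xs. f (i # tl xs))"
    by (rule recursive_primrec[OF recursive_const recursive_add[OF recursive_proj[of 1] f']]) auto
  then obtain s where s: "\<And>xs. length xs = Suc n \<Longrightarrow> computes s xs (\<Sum>i<hd xs. f (i # tl xs))"
    unfolding recursive_def by blast
  obtain t where t: "\<And>xs. length xs = n \<Longrightarrow> computes t xs (b xs)"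
    using assms unfolding recursive_def by blast
  have "computes (Comp s (t # map Proj [0..<n])) xs (\<Sum>i<b xs. f (i # xs))" if l: "length xs = n" for xs
  proof (rule computes.comp)
    show "list_all2 (\<lambda>g. computes g xs) (t # map Proj [0..<n]) (b xs # xs)"
      using l t computes_map_Proj[of "[0..<n]" xs] map_nth[of xs] by simp
    show "computes s (b xs # xs) (\<Sum>i<b xs. f (i # xs))" using s[of "b xs # xs"] l by simp
  qed
  then show ?thesis unfolding recursive_def by blast
qed

lemma recursive_power2:
  assumes "recursive n f"
  shows "recursive n (\<lambda>xs. 2 ^ f xs)"
proof -
  have "recursive (Suc 0) (\<lambda>xs. 2 ^ (xs ! 0))"
    by (rule recursive_primrec[OF recursive_const
        recursive_add[OF recursive_proj[of 1] recursive_proj[of 1]]]) auto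
  from recursive_comp1[OF this[folded One_nat_def] assms] show ?thesis by simp
qed

lemma recursive_triangle: "recursive 1 (\<lambda>xs. triangle (xs ! 0))"
  unfolding One_nat_def
  by (rule recursive_primrec[OF recursive_const
      recursive_add[OF recursive_proj[of 1] recursive_comp1[OF recursive_Suc recursive_proj[of 0]]]]) auto

text \<open>A list cell is coded by the successor of the Cantor pairing
  \<open>triangle (x + y) + x\<close>, so addition, successor and triangle numbers suffice.\<close>

lemma recursive_list_encode_Cons:
  assumes "recursive n f" "recursive n (\<lambda>xs. list_encode (l xs))"
  shows "recursive n (\<lambda>xs. list_encode (f xs # l xs))"
proof -
  have "recursive n (\<lambda>xs. triangle (f xs + list_encode (l xs)))"
    using recursive_comp1[OF recursive_triangle recursive_add[OF assms]] by simp
  from recursive_comp1[OF recursive_Suc recursive_add[OF this assms(1)]]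
  show ?thesis by (simp add: prod_encode_def)
qed

lemma recursive_list_encode_Nil: "recursive n (\<lambda>xs. list_encode [])"
  by (simp add: recursive_const)

section \<open>Stack automata with one stack symbol\<close>

text \<open>
  With one stack symbol and no erasing, a configuration is determined by the state, the remaining
  input, the height of the stack, and the position of the head (\<open>0\<close> on \<open>Bot\<close>, \<open>k + 1\<close> on \<open>Top\<close>).
\<close>

definition cell_at :: "nat \<Rightarrow> nat \<Rightarrow> nat cell" where
  "cell_at k p = (if p = 0 then Bot else if p \<le> k then Sym 0 else Top)"

type_synonym pos_config = "nat \<times> nat list \<times> nat \<times> nat"

fun config_of :: "pos_config \<Rightarrow> (nat, nat, nat) config" where
  "config_of (q, u, k, p) =
     (q, u, map (cell_at k) [0..<Suc p], map (cell_at k) [Suc p..<Suc (Suc k)])"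

fun head_ok :: "pos_config \<Rightarrow> bool" where
  "head_ok (q, u, k, p) \<longleftrightarrow> p \<le> Suc k"

fun height :: "pos_config \<Rightarrow> nat" where
  "height (q, u, k, p) = k"

fun move :: "nat instr \<Rightarrow> nat \<Rightarrow> nat \<Rightarrow> nat \<Rightarrow> nat \<Rightarrow> bool" where
  "move Stay k p k' p' \<longleftrightarrow> p = k \<and> k' = k \<and> p' = k"
| "move (Push g) k p k' p' \<longleftrightarrow> g = 0 \<and> p = k \<and> k' = Suc k \<and> p' = Suc k"
| "move Pop k p k' p' \<longleftrightarrow> False"
| "move Down k p k' p' \<longleftrightarrow> p = Suc p' \<and> k' = k \<and> p' \<le> k"
| "move Hold k p k' p' \<longleftrightarrow> k' = k \<and> p' = p \<and> p \<le> Suc k"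
| "move Up k p k' p' \<longleftrightarrow> k' = k \<and> p' = Suc p \<and> p \<le> k"

inductive pos_step :: "(nat, nat, nat) sa \<Rightarrow> pos_config \<Rightarrow> pos_config \<Rightarrow> bool" for M where
  stay: "(q, a, cell_at k k, q', Stay) \<in> sa_delta M \<Longrightarrow> u \<in> lists (sa_inputs M)
    \<Longrightarrow> pos_step M (q, word_of a @ u, k, k) (q', u, k, k)"
| push: "(q, a, cell_at k k, q', Push 0) \<in> sa_delta M \<Longrightarrow> u \<in> lists (sa_inputs M)
    \<Longrightarrow> pos_step M (q, word_of a @ u, k, k) (q', u, Suc k, Suc k)"
| down: "(q, a, cell_at k (Suc p), q', Down) \<in> sa_delta M \<Longrightarrow> u \<in> lists (sa_inputs M) \<Longrightarrow> p \<le> k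
    \<Longrightarrow> pos_step M (q, word_of a @ u, k, Suc p) (q', u, k, p)"
| hold: "(q, a, cell_at k p, q', Hold) \<in> sa_delta M \<Longrightarrow> u \<in> lists (sa_inputs M) \<Longrightarrow> p \<le> Suc k
    \<Longrightarrow> pos_step M (q, word_of a @ u, k, p) (q', u, k, p)"
| up: "(q, a, cell_at k p, q', Up) \<in> sa_delta M \<Longrightarrow> u \<in> lists (sa_inputs M) \<Longrightarrow> p \<le> k
    \<Longrightarrow> pos_step M (q, word_of a @ u, k, p) (q', u, k, Suc p)"

lemma pos_step_iff:
  "pos_step M (q, w, k, p) (q', u, k', p') \<longleftrightarrow>
     (\<exists>a \<iota>. w = word_of a @ u \<and> u \<in> lists (sa_inputs M) \<and>
       (q, a, cell_at k p, q', \<iota>) \<in> sa_delta M \<and> move \<iota> k p k' p')" (is "?L \<longleftrightarrow> ?R")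
proof
  assume ?L
  then show ?R
  proof cases
    case (stay a)
    then show ?thesis by (intro exI[of _ a] exI[of _ Stay]) auto
  next
    case (push a)
    then show ?thesis by (intro exI[of _ a] exI[of _ "Push 0"]) auto
  next
    case (down a)
    then show ?thesis by (intro exI[of _ a] exI[of _ Down]) auto
  next
    case (hold a)
    then show ?thesis by (intro exI[of _ a] exI[of _ Hold]) auto
  next
    case (up a)
    then show ?thesis by (intro exI[of _ a] exI[of _ Up]) auto
  qed
next
  assume ?R
  then obtain a \<iota> where "w = word_of a @ u" "u \<in> lists (sa_inputs M)"
    "(q, a, cell_at k p, q', \<iota>) \<in> sa_delta M" "move \<iota> k p k' p'" by blast
  then show ?L by (cases \<iota>) (auto intro: pos_step.intros)
qed

definition unary :: "(nat, nat, nat) sa \<Rightarrow> bool" where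
  "unary M \<longleftrightarrow> sa_syms M = {0} \<and> (\<forall>(q, a, y, p, \<iota>) \<in> sa_delta M. \<iota> \<in> {Stay, Push 0, Down, Hold, Up})"

lemma cells_eq: "map (cell_at k) [0..<Suc (Suc k)] = Bot # map Sym (replicate k 0) @ [Top]"
proof -
  have "map (cell_at k) [0..<Suc k] = Bot # replicate k (Sym 0)"
    by (rule nth_equalityI) (auto simp: cell_at_def nth_Cons simp del: upt_Suc split: nat.splits)
  then show ?thesis by (simp add: cell_at_def)
qed

lemma stack_contents_unary:
  assumes "unary M"
  shows "s \<in> stack_contents M \<longleftrightarrow> (\<exists>k. s = map (cell_at k) [0..<Suc (Suc k)])"
proof -
  have "s \<in> lists {0} \<longleftrightarrow> (\<exists>k. s = replicate k 0)" for s :: "nat list"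
    by (metis in_lists_conv_set in_set_replicate replicate_length_same singleton_iff)
  then show ?thesis
    using assms unfolding cells_eq stack_contents_def unary_def by (auto intro: exI[of _ "replicate _ 0"])
qed

lemma cells_split: "p \<le> Suc k \<Longrightarrow>
  map (cell_at k) [0..<Suc p] @ map (cell_at k) [Suc p..<Suc (Suc k)] = map (cell_at k) [0..<Suc (Suc k)]"
  unfolding map_append[symmetric] using upt_add_eq_append[of 0 "Suc p" "Suc k - p"] by simp

lemma cell_at_Suc [simp]: "cell_at k (Suc k) = Top"
  by (simp add: cell_at_def)

lemma cell_at_eq [simp]:
  "cell_at k p = Top \<longleftrightarrow> k < p" "cell_at k p = Bot \<longleftrightarrow> p = 0" "cell_at k 0 = Bot"
  "cell_at k p = Sym 0 \<longleftrightarrow> 0 < p \<and> p \<le> k"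
  by (auto simp: cell_at_def)

lemma upper_eq_Top:
  assumes "p \<le> Suc k" "map (cell_at k) [Suc p..<Suc (Suc k)] = [Top]"
  shows "p = k"
  using arg_cong[OF assms(2), of length] assms(1) by (simp del: upt_Suc)

lemma pos_steps_head_ok: "(pos_step M)\<^sup>*\<^sup>* c d \<Longrightarrow> head_ok c \<Longrightarrow> head_ok d"
  by (induction rule: rtranclp_induct) (auto elim: pos_step.cases)

lemma step_config_of:
  assumes "unary M" "head_ok c" "step M (config_of c) c'"
  obtains d where "c' = config_of d" "pos_step M c d" "head_ok d" "height c \<le> height d"
proof -
  obtain q w k p where c: "c = (q, w, k, p)" by (cases c)
  have p: "p \<le> Suc k" using assms(2) c by simp
  have "write_step M (config_of c) c' \<or> read_step M (config_of c) c'"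
    using assms(3) by (simp add: step_def)
  then have "\<exists>d. c' = config_of d \<and> pos_step M c d \<and> head_ok d \<and> height c \<le> height d"
  proof
    assume "write_step M (config_of c) c'"
    then show ?thesis
    proof cases
      case (stay q1 a x q2 u l)
      then have x: "x = cell_at k p" "p = k"
        using p upper_eq_Top[OF p] unfolding c by auto
      then show ?thesis using stay pos_step.stay[of q a k q2 M u] unfolding c
        by (intro exI[of _ "(q2, u, k, k)"]) auto
    next
      case (push q1 a x q2 y u l)
      then have x: "x = cell_at k p" "p = k"
        using p upper_eq_Top[OF p] unfolding c by auto
      have y: "y = 0" using push(3) assms(1) by (auto simp: unary_def)
      have "map (cell_at k) [0..<Suc k] = map (cell_at (Suc k)) [0..<Suc k]"
        by (auto simp: cell_at_def)
      then show ?thesis using push x y pos_step.push[of q a k q2 M u] unfolding c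
        by (intro exI[of _ "(q2, u, Suc k, Suc k)"]) (auto simp: cell_at_def)
    next
      case (pop q1 a x q2 u l)
      then show ?thesis using assms(1) by (auto simp: unary_def)
    qed
  next
    assume "read_step M (config_of c) c'"
    then show ?thesis
    proof cases
      case (down q1 a x q2 u l r)
      then have x: "x = cell_at k p" "l = map (cell_at k) [0..<p]"
        "r = map (cell_at k) [Suc p..<Suc (Suc k)]"
        unfolding c by auto
      with down obtain p' where p': "p = Suc p'" by (cases p) auto
      have "map (cell_at k) [p..<Suc (Suc k)] = cell_at k p # r"
        using p by (simp add: upt_conv_Cons x(3) del: upt_Suc)
      then show ?thesis using down x p p' pos_step.down[of q a k p' q2 M u] unfolding c
        by (intro exI[of _ "(q2, u, k, p')"]) (auto simp del: upt_Suc)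
    next
      case (hold q1 a x q2 u l r)
      then have x: "x = cell_at k p" "l = map (cell_at k) [0..<p]"
        "r = map (cell_at k) [Suc p..<Suc (Suc k)]"
        unfolding c by auto
      then show ?thesis using hold p pos_step.hold[of q a k p q2 M u] unfolding c
        by (intro exI[of _ "(q2, u, k, p)"]) auto
    next
      case (up q1 a x q2 u l y r)
      then have x: "x = cell_at k p" "l = map (cell_at k) [0..<p]"
        "y # r = map (cell_at k) [Suc p..<Suc (Suc k)]"
        unfolding c by auto
      have pk: "p \<le> k" using arg_cong[OF x(3), of length] by (simp del: upt_Suc)
      then have "map (cell_at k) [Suc p..<Suc (Suc k)] =
          cell_at k (Suc p) # map (cell_at k) [Suc (Suc p)..<Suc (Suc k)]"
        by (simp add: upt_conv_Cons del: upt_Suc)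
      with x(3) have "y = cell_at k (Suc p)" "r = map (cell_at k) [Suc (Suc p)..<Suc (Suc k)]" by auto
      then show ?thesis using up x pk pos_step.up[of q a k p q2 M u] unfolding c
        by (intro exI[of _ "(q2, u, k, Suc p)"]) auto
    qed
  qed
  then show thesis using that by blast
qed

lemma pos_step_config_of:
  assumes "unary M" "pos_step M c d"
  shows "step M (config_of c) (config_of d)"
  using assms(2)
proof cases
  have cont: "map (cell_at k) [0..<Suc (Suc k)] \<in> stack_contents M" for k
    using stack_contents_unary[OF assms(1)] by blast
  have ex: "map (cell_at k) [0..<p] @ cell_at k p # map (cell_at k) [Suc p..<Suc (Suc k)] \<in> stack_contents M"
    if "p \<le> Suc k" for k p
    using cont[of k] cells_split[OF that] by simp
  {
    case (stay q a k q' u)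
    have t: "map (cell_at k) [Suc k..<Suc (Suc k)] = [Top]" by simp
    show ?thesis using write_step.stay[OF stay(3) _ stay(4), of "map (cell_at k) [0..<k]"] ex[of k k] stay(1,2) t
      by (simp add: step_def)
  next
    case (push q a k q' u)
    have t: "map (cell_at k) [Suc k..<Suc (Suc k)] = [Top]" by simp
    have e: "map (cell_at (Suc k)) [0..<k] = map (cell_at k) [0..<k]" "cell_at (Suc k) k = cell_at k k"
      by (auto simp: cell_at_def)
    show ?thesis using write_step.push[OF push(3) _ push(4), of "map (cell_at k) [0..<k]"] ex[of k k] push(1,2) t
      by (simp add: step_def e) (simp add: cell_at_def)
  next
    case (down q a k p q' u)
    have t: "map (cell_at k) [Suc p..<Suc (Suc k)] = cell_at k (Suc p) # map (cell_at k) [Suc (Suc p)..<Suc (Suc k)]"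
      using down by (simp add: upt_conv_Cons del: upt_Suc)
    show ?thesis using read_step.down[OF down(3) _ down(4), of "map (cell_at k) [0..<Suc p]"
          "map (cell_at k) [Suc (Suc p)..<Suc (Suc k)]"] ex[of "Suc p" k] down(1,2,5) t
      by (simp add: step_def del: upt_Suc) (simp add: upt_Suc)
  next
    case (hold q a k p q' u)
    show ?thesis using read_step.hold[OF hold(3,4), of "map (cell_at k) [0..<p]"
          "map (cell_at k) [Suc p..<Suc (Suc k)]"] ex[of p k] hold(1,2,5)
      by (simp add: step_def)
  next
    case (up q a k p q' u)
    have t: "map (cell_at k) [Suc p..<Suc (Suc k)] = cell_at k (Suc p) # map (cell_at k) [Suc (Suc p)..<Suc (Suc k)]"
      using up by (simp add: upt_conv_Cons del: upt_Suc)
    show ?thesis using read_step.up[OF up(3,4), of "map (cell_at k) [0..<p]" "cell_at k (Suc p)"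
          "map (cell_at k) [Suc (Suc p)..<Suc (Suc k)]"] ex[of p k] up(1,2,5) t
      by (simp add: step_def del: upt_Suc) (simp add: upt_Suc)
  }
qed

lemma stack_size_config_of: "head_ok c \<Longrightarrow> stack_size (config_of c) = height c"
  by (cases c) (auto simp del: upt_Suc)

text \<open>Without erasing the height never decreases, so the maximal stack size of a computation
  is its final height. Weak space thereby becomes a question about reachable final
  configurations.\<close>

lemma successively_pos_steps:
  assumes "unary M" "head_ok c" "successively (step M) cs" "cs \<noteq> []" "hd cs = config_of c"
  shows "\<exists>d. (pos_step M)\<^sup>*\<^sup>* c d \<and> head_ok d \<and> last cs = config_of d \<and> computation_space cs = height d \<and>
    height c \<le> height d"
  using assms(2-)
proof (induction cs arbitrary: c)
  case (Cons x cs)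
  show ?case
  proof (cases cs)
    case Nil
    then show ?thesis using Cons.prems
      by (intro exI[of _ c]) (auto simp: computation_space_def stack_size_config_of)
  next
    case (Cons y ys)
    then have st: "step M (config_of c) y" and su: "successively (step M) cs"
      using Cons.prems by auto
    from step_config_of[OF assms(1) Cons.prems(1) st] obtain d where
      d: "y = config_of d" "pos_step M c d" "head_ok d" "height c \<le> height d" by blast
    from Cons.IH[OF d(3) su] Cons d(1) obtain e where
      e: "(pos_step M)\<^sup>*\<^sup>* d e" "head_ok e" "last cs = config_of e" "computation_space cs = height e"
        "height d \<le> height e" by auto
    have "computation_space (x # cs) = max (stack_size x) (computation_space cs)"
      using Cons by (simp add: computation_space_def)
    also have "\<dots> = height e"
      using Cons.prems(1,4) e d stack_size_config_of by simp
    finally show ?thesis using e d Cons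
      by (intro exI[of _ e]) (auto intro: converse_rtranclp_into_rtranclp)
  qed
qed simp

lemma pos_steps_successively:
  assumes "unary M" "(pos_step M)\<^sup>*\<^sup>* c d"
  shows "\<exists>cs. successively (step M) cs \<and> cs \<noteq> [] \<and> hd cs = config_of c \<and> last cs = config_of d"
  using assms(2)
proof (induction rule: converse_rtranclp_induct)
  case base
  show ?case by (intro exI[of _ "[config_of d]"]) simp
next
  case (step b b')
  then obtain cs where cs: "successively (step M) cs" "cs \<noteq> []" "hd cs = config_of b'" "last cs = config_of d"
    by blast
  with pos_step_config_of[OF assms(1) step.hyps(1)] show ?case
    by (intro exI[of _ "config_of b # cs"]) (auto simp: successively_Cons)
qed

lemma accepting_computation_pos:
  assumes "unary M"
  shows "(\<exists>cs. accepting_computation M w cs \<and> computation_space cs = k) \<longleftrightarrow>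
    w \<in> lists (sa_inputs M) \<and>
    (\<exists>q p. (pos_step M)\<^sup>*\<^sup>* (sa_init M, w, 0, 0) (q, [], k, p) \<and> q \<in> sa_finals M)" (is "?L \<longleftrightarrow> ?R")
proof
  let ?c = "(sa_init M, w, 0, 0)"
  have c: "config_of ?c = (sa_init M, w, [Bot], [Top])" by (simp add: cell_at_def)
  {
    assume ?L
    then obtain cs where cs: "w \<in> lists (sa_inputs M)" "cs \<noteq> []" "hd cs = config_of ?c"
      "successively (step M) cs" "computation_space cs = k" "fst (snd (last cs)) = []"
      "fst (last cs) \<in> sa_finals M"
      unfolding accepting_computation_def computation_def partial_computation_def c by blast
    from successively_pos_steps[OF assms _ cs(4,2,3)] obtain d where
      "(pos_step M)\<^sup>*\<^sup>* ?c d" "last cs = config_of d" "computation_space cs = height d" by auto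
    with cs show ?R by (cases d) auto
  next
    assume ?R
    then obtain q p where w: "w \<in> lists (sa_inputs M)" "(pos_step M)\<^sup>*\<^sup>* ?c (q, [], k, p)" "q \<in> sa_finals M"
      by blast
    from pos_steps_successively[OF assms w(2)] obtain cs where
      cs: "successively (step M) cs" "cs \<noteq> []" "hd cs = config_of ?c" "last cs = config_of (q, [], k, p)"
      by blast
    from successively_pos_steps[OF assms _ cs(1-3)] obtain d where
      d: "last cs = config_of d" "computation_space cs = height d" "head_ok d" by auto
    have "stack_size (last cs) = k"
    proof -
      have "head_ok (q, [], k, p)" using pos_steps_head_ok[OF w(2)] by simp
      from stack_size_config_of[OF this] show ?thesis using cs(4) by simp
    qed
    with d have "computation_space cs = k" using stack_size_config_of by auto
    with w cs show ?L
      unfolding accepting_computation_def computation_def partial_computation_def c[symmetric]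
      by (intro exI[of _ cs]) auto
  }
qed

section \<open>The automaton searching for errors\<close>

text \<open>
  Input words are sequences of blocks, each terminated by the letter \<open>0\<close>; the value of register \<open>r\<close>
  in a block is the number of occurrences of the letter \<open>Suc r\<close>, in any order. The functions below
  describe what the automaton accepts from its various states with stack height \<open>k\<close>. The control
  is not written in the word: it is determined by the blocks and tracked in the finite state.
\<close>

fun differs :: "nat \<Rightarrow> nat list \<Rightarrow> nat \<Rightarrow> bool" where
  "differs r [] k \<longleftrightarrow> False"
| "differs r (a # u) k \<longleftrightarrow>
     (if a = 0 then 0 < k
      else if a = Suc r then (case k of 0 \<Rightarrow> True | Suc k' \<Rightarrow> differs r u k')
      else differs r u k)"

fun counts :: "nat \<Rightarrow> nat \<Rightarrow> bool \<Rightarrow> nat list \<Rightarrow> nat \<Rightarrow> nat \<Rightarrow> bool" where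
  "counts r s skip [] p k \<longleftrightarrow> False"
| "counts r s skip (a # u) p k \<longleftrightarrow>
     (if a = 0 then p = k \<and> differs r u k
      else if a = Suc s then counts r s False u (if skip then p else Suc p) k
      else counts r s skip u p k)"

definition check :: "cmd list \<Rightarrow> nat \<Rightarrow> nat list \<Rightarrow> nat \<Rightarrow> bool" where
  "check K r u k \<longleftrightarrow> (case update K r of (s, d) \<Rightarrow>
     counts r s (d = Dec) u (if d = Inc then 1 else 0) k)"

fun scan :: "nat \<Rightarrow> cmd list \<Rightarrow> bool \<Rightarrow> nat list \<Rightarrow> nat \<Rightarrow> bool" where
  "scan m K z [] k \<longleftrightarrow> False"
| "scan m K z (a # u) k \<longleftrightarrow>
     (case a of
        0 \<Rightarrow> next_ctrl K z \<noteq> [] \<and>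
          (scan m (next_ctrl K z) False u k \<or> (\<exists>r<m. check (next_ctrl K z) r u k))
      | Suc r \<Rightarrow> scan m K (z \<or> tests K r) u k)"

definition start :: "nat \<Rightarrow> cmd list \<Rightarrow> nat list \<Rightarrow> nat \<Rightarrow> bool" where
  "start m K u k \<longleftrightarrow> K \<noteq> [] \<and> (scan m K False u k \<or> (\<exists>r<m. check K r u k))"

definition accepts :: "nat \<Rightarrow> cmd list \<Rightarrow> nat \<Rightarrow> nat list \<Rightarrow> nat \<Rightarrow> bool" where
  "accepts m K n u k \<longleftrightarrow>
     k = Suc n \<and> differs 1 u k \<or> k = 0 \<and> (\<exists>r<m. r \<noteq> 1 \<and> differs r u 0) \<or> start m K u k"

datatype st = Init | Chain nat | Guess | Rewind | Start "cmd list" | Scan "cmd list" bool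
  | Count nat nat bool | Turn nat | Compare nat | Fin

instance st :: countable by countable_datatype

text \<open>Even numbers are reserved for the chain, so that its states are given by an explicit
  formula; all other states share the odd numbers, whose particular values do not matter.\<close>

fun st_code :: "st \<Rightarrow> nat" where
  "st_code (Chain i) = 2 * i"
| "st_code s = Suc (2 * to_nat s)"

lemma st_code_odd: "odd (st_code s) \<longleftrightarrow> st_code s = Suc (2 * to_nat s)" "odd (st_code s) \<longleftrightarrow> (\<forall>i. s \<noteq> Chain i)"
  by (cases s; simp; presburger)+

lemma inj_st_code: "inj st_code"
proof (rule injI)
  fix s t assume eq: "st_code s = st_code t"
  show "s = t"
  proof (cases "odd (st_code s)")
    case True
    then show ?thesis using eq st_code_odd(1)[of s] st_code_odd(1)[of t] by simp
  next
    case False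
    then obtain i j where "s = Chain i" "t = Chain j" using eq st_code_odd(2) by metis
    then show ?thesis using eq by simp
  qed
qed

lemma st_code_eq [simp]: "st_code s = st_code t \<longleftrightarrow> s = t"
  using inj_st_code by (auto dest: injD)

declare st_code.simps [simp del]

text \<open>\<open>C\<close> is a finite set of controls to be tracked in the state. The bound
  \<open>m\<close> delimits the registers recorded in a block; it must cover every source and every
  tested register, so that a block determines the next block and the next control.\<close>

locale history_automaton =
  fixes K0 :: "cmd list" and C :: "cmd list set" and m :: nat
  assumes finite_C: "finite C" and K0: "K0 \<in> C" and C_next: "K \<in> C \<Longrightarrow> next_ctrl K z \<in> C"
    and m_update: "K \<in> C \<Longrightarrow> r < m \<Longrightarrow> fst (update K r) < m"
    and m_tests: "K \<in> C \<Longrightarrow> tests K r \<Longrightarrow> r < m"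
    and m_1: "1 < m"
begin

text \<open>
  \<open>Count r s skip\<close> climbs from the bottom, one cell per unit of register \<open>s\<close>, and has to end exactly
  at the top, so that the guessed height is the correct next value of register \<open>r\<close>; starting one cell
  higher or skipping one unit accounts for \<open>Inc\<close> and \<open>Dec\<close>. \<open>Turn r\<close> verifies the position by
  scanning \<open>Top\<close>. \<open>Compare r\<close> descends in the next block and accepts unless it ends at the bottom.
\<close>

inductive transition :: "st \<Rightarrow> nat option \<Rightarrow> nat cell \<Rightarrow> st \<Rightarrow> nat instr \<Rightarrow> bool" where
  "transition Init None Bot (Chain 0) (Push 0)"
| "r < m \<Longrightarrow> r \<noteq> 1 \<Longrightarrow> transition Init None Bot (Compare r) Stay"
| "transition Init None Bot Guess Stay"
| "y \<in> {Bot, Sym 0} \<Longrightarrow> transition Guess None y Guess (Push 0)"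
| "y \<in> {Bot, Sym 0} \<Longrightarrow> transition Guess None y Rewind Stay"
| "transition Rewind None (Sym 0) Rewind Down"
| "transition Rewind None Bot (Start K0) Hold"
| "K \<in> C \<Longrightarrow> K \<noteq> [] \<Longrightarrow> transition (Start K) None Bot (Scan K False) Hold"
| "K \<in> C \<Longrightarrow> K \<noteq> [] \<Longrightarrow> r < m \<Longrightarrow> update K r = (s, d) \<Longrightarrow>
    transition (Start K) None Bot (Count r s (d = Dec)) (if d = Inc then Up else Hold)"
| "K \<in> C \<Longrightarrow> r < m \<Longrightarrow> transition (Scan K z) (Some (Suc r)) Bot (Scan K (z \<or> tests K r)) Hold"
| "K \<in> C \<Longrightarrow> transition (Scan K z) (Some 0) Bot (Start (next_ctrl K z)) Hold"
| "y \<in> {Bot, Sym 0} \<Longrightarrow> r < m \<Longrightarrow> s < m \<Longrightarrow> r' < m \<Longrightarrow> r' \<noteq> s \<Longrightarrow>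
    transition (Count r s skip) (Some (Suc r')) y (Count r s skip) Hold"
| "y \<in> {Bot, Sym 0} \<Longrightarrow> r < m \<Longrightarrow> s < m \<Longrightarrow>
    transition (Count r s skip) (Some (Suc s)) y (Count r s False) (if skip then Hold else Up)"
| "y \<in> {Bot, Sym 0} \<Longrightarrow> r < m \<Longrightarrow> s < m \<Longrightarrow> transition (Count r s skip) None y (Turn r) Up"
| "r < m \<Longrightarrow> transition (Turn r) (Some 0) Top (Compare r) Down"
| "r < m \<Longrightarrow> transition (Compare r) (Some (Suc r)) (Sym 0) (Compare r) Down"
| "r < m \<Longrightarrow> transition (Compare r) (Some (Suc r)) Bot Fin Hold"
| "y \<in> {Bot, Sym 0} \<Longrightarrow> r < m \<Longrightarrow> r' < m \<Longrightarrow> r' \<noteq> r \<Longrightarrow>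
    transition (Compare r) (Some (Suc r')) y (Compare r) Hold"
| "r < m \<Longrightarrow> transition (Compare r) (Some 0) (Sym 0) Fin Hold"
| "y \<in> {Bot, Sym 0} \<Longrightarrow> a \<le> m \<Longrightarrow> transition Fin (Some a) y Fin Hold"

text \<open>
  The chain pushes \<open>n + 1\<close> symbols and thereby checks the initial value of register \<open>1\<close>. It is the
  only part of the automaton that depends on \<open>n\<close>, and its states have explicit numbers.
\<close>

inductive chain :: "nat \<Rightarrow> st \<Rightarrow> nat option \<Rightarrow> nat cell \<Rightarrow> st \<Rightarrow> nat instr \<Rightarrow> bool" for n where
  "i < n \<Longrightarrow> chain n (Chain i) None (Sym 0) (Chain (Suc i)) (Push 0)"
| "chain n (Chain n) None (Sym 0) (Compare 1) Stay"

definition coded where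
  "coded T = {(st_code s, a, y, st_code s', \<iota>) | s a y s' \<iota>. T s a y s' \<iota>}"

text \<open>States and inputs are padded to an initial segment of the numbers so that their set
  codes are simple sums. The surplus letters occur in no accepted word.\<close>

definition automaton :: "nat \<Rightarrow> nat \<Rightarrow> (nat, nat, nat) sa" where
  "automaton n b = \<lparr>sa_states = {..<b}, sa_inputs = {..<b}, sa_syms = {0},
     sa_delta = coded transition \<union> coded (chain n), sa_init = st_code Init, sa_finals = {st_code Fin}\<rparr>"

text \<open>
  A backward invariant: it holds in every configuration from which the automaton can accept with
  final stack height \<open>h\<close>.
\<close>

fun accepts_from :: "nat \<Rightarrow> nat \<Rightarrow> st \<Rightarrow> nat list \<Rightarrow> nat \<Rightarrow> nat \<Rightarrow> bool" where
  "accepts_from n h Init u k p \<longleftrightarrow> (k = 0 \<longrightarrow> accepts m K0 n u h)"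
| "accepts_from n h (Chain i) u k p \<longleftrightarrow> h = k + (n - i) \<and> differs 1 u h"
| "accepts_from n h Guess u k p \<longleftrightarrow> start m K0 u h"
| "accepts_from n h Rewind u k p \<longleftrightarrow> h = k \<and> start m K0 u h"
| "accepts_from n h (Start K) u k p \<longleftrightarrow> h = k \<and> start m K u h"
| "accepts_from n h (Scan K z) u k p \<longleftrightarrow> h = k \<and> scan m K z u h"
| "accepts_from n h (Count r s skip) u k p \<longleftrightarrow> h = k \<and> counts r s skip u p h"
| "accepts_from n h (Turn r) u k p \<longleftrightarrow> h = k \<and> p = Suc k \<and> (\<exists>v. u = 0 # v \<and> differs r v h)"
| "accepts_from n h (Compare r) u k p \<longleftrightarrow> h = k \<and> differs r u p"
| "accepts_from n h Fin u k p \<longleftrightarrow> h = k"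

section \<open>Soundness of the automaton with respect to \<open>accepts\<close>\<close>

lemma transition_sound:
  assumes "transition s a (cell_at k p) s' \<iota>" "move \<iota> k p k' p'" "accepts_from n h s' u k' p'"
  shows "accepts_from n h s (word_of a @ u) k p"
  using assms
  by cases (auto simp: accepts_def start_def check_def less_Suc_eq_le
      split: if_splits nat.splits dest: le_antisym)

lemma chain_sound:
  assumes "chain n s a (cell_at k p) s' \<iota>" "move \<iota> k p k' p'" "accepts_from n h s' u k' p'"
  shows "accepts_from n h s (word_of a @ u) k p"
  using assms by cases auto

lemma transition_letters: "transition s a y s' \<iota> \<Longrightarrow> set (word_of a) \<subseteq> {..m}"
  by (induction rule: transition.induct) auto

lemma chain_letters: "chain n s a y s' \<iota> \<Longrightarrow> a = None"
  by (induction rule: chain.induct) auto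

text \<open>Induction backwards from the accepting configuration, with \<open>accepts_from\<close>
  as invariant. The bound on the letters is carried along because the input alphabet may exceed
  \<open>{..m}\<close>.\<close>

lemma automaton_sound:
  assumes "(pos_step (automaton n b))\<^sup>*\<^sup>* (st_code s, u, k, p) (st_code Fin, [], h, p')"
  shows "accepts_from n h s u k p \<and> set u \<subseteq> {..m}"
proof -
  have "\<forall>s. q = st_code s \<longrightarrow> accepts_from n h s u k p \<and> set u \<subseteq> {..m}"
    if "(pos_step (automaton n b))\<^sup>*\<^sup>* (q, u, k, p) (st_code Fin, [], h, p')" for q u k p
    using that
  proof (induction "(q, u, k, p)" arbitrary: q u k p rule: converse_rtranclp_induct)
    case base
    show ?case by auto
  next
    case (step d)
    obtain q1 u1 k1 p1 where d: "d = (q1, u1, k1, p1)" by (cases d)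
    show ?case
    proof (intro allI impI)
      fix s assume q: "q = st_code s"
      from step(1)[unfolded d pos_step_iff] obtain a \<iota> where u: "u = word_of a @ u1"
        and dl: "(q, a, cell_at k p, q1, \<iota>) \<in> sa_delta (automaton n b)" and mv: "move \<iota> k p k1 p1" by blast
      from dl obtain s1 where s1: "q1 = st_code s1"
        and tr: "transition s a (cell_at k p) s1 \<iota> \<or> chain n s a (cell_at k p) s1 \<iota>"
        by (auto simp: automaton_def coded_def q)
      have IH: "accepts_from n h s1 u1 k1 p1" "set u1 \<subseteq> {..m}" using step(3)[OF d] s1 by auto
      have "accepts_from n h s u k p"
        unfolding u using tr transition_sound[OF _ mv IH(1)] chain_sound[OF _ mv IH(1)] by blast
      moreover have "set (word_of a) \<subseteq> {..m}"
        using tr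
      proof
        assume "chain n s a (cell_at k p) s1 \<iota>"
        from chain_letters[OF this] show ?thesis by simp
      qed (rule transition_letters)
      ultimately show "accepts_from n h s u k p \<and> set u \<subseteq> {..m}" using IH(2) by (simp add: u)
    qed
  qed
  with assms show ?thesis by blast
qed

section \<open>Completeness of the automaton with respect to \<open>accepts\<close>\<close>

definition reaches :: "nat \<Rightarrow> nat \<Rightarrow> nat \<Rightarrow> st \<Rightarrow> nat list \<Rightarrow> nat \<Rightarrow> nat \<Rightarrow> bool" where
  "reaches n b h s u k p \<longleftrightarrow>
     (\<exists>p'. (pos_step (automaton n b))\<^sup>*\<^sup>* (st_code s, u, k, p) (st_code Fin, [], h, p'))"

context
  fixes n b h :: nat
  assumes b: "m < b"
begin

lemma reaches_step:
  assumes "transition s a (cell_at k p) s' \<iota> \<or> chain n s a (cell_at k p) s' \<iota>" "move \<iota> k p k' p'"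
    "set u \<subseteq> {..m}" "reaches n b h s' u k' p'"
  shows "reaches n b h s (word_of a @ u) k p"
proof -
  have "u \<in> lists {..<b}" using assms(3) b by auto
  then have "pos_step (automaton n b) (st_code s, word_of a @ u, k, p) (st_code s', u, k', p')"
    unfolding pos_step_iff using assms(1,2)
    by (intro exI[of _ a] exI[of _ \<iota>]) (auto simp: automaton_def coded_def)
  with assms(4) show ?thesis unfolding reaches_def by (blast intro: converse_rtranclp_into_rtranclp)
qed

lemma reaches_read:
  assumes "transition s (Some a) (cell_at k p) s' \<iota>" "move \<iota> k p k' p'"
    "set u \<subseteq> {..m}" "reaches n b h s' u k' p'"
  shows "reaches n b h s (a # u) k p"
  using reaches_step[OF disjI1[OF assms(1)] assms(2-)] by simp

lemma reaches_silent:
  assumes "transition s None (cell_at k p) s' \<iota> \<or> chain n s None (cell_at k p) s' \<iota>" "move \<iota> k p k' p'"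
    "set u \<subseteq> {..m}" "reaches n b h s' u k' p'"
  shows "reaches n b h s u k p"
  using reaches_step[OF assms] by simp

lemma cell_at_below: "p \<le> k \<Longrightarrow> cell_at k p \<in> {Bot, Sym 0}"
  by (simp add: cell_at_def)

lemma reaches_Fin: "set u \<subseteq> {..m} \<Longrightarrow> p \<le> h \<Longrightarrow> reaches n b h Fin u h p"
proof (induction u)
  case Nil
  then show ?case by (auto simp: reaches_def)
next
  case (Cons a u)
  show ?case
    by (rule reaches_read[OF transition.intros(20)[OF cell_at_below]]) (use Cons in auto)
qed

lemma reaches_Compare:
  assumes "r < m" "set u \<subseteq> {..m}" "p \<le> h" "differs r u p"
  shows "reaches n b h (Compare r) u h p"
  using assms(2-)
proof (induction u arbitrary: p)
  case (Cons a u)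
  show ?case
  proof (cases a)
    case 0
    show ?thesis unfolding 0
      by (rule reaches_read[of _ _ _ _ Fin Hold]) (use 0 Cons assms(1) in \<open>auto intro: transition.intros reaches_Fin simp: cell_at_def\<close>)
  next
    case (Suc r')
    show ?thesis
    proof (cases "r' = r")
      case True
      show ?thesis
      proof (cases p)
        case 0
        show ?thesis unfolding 0 Suc True
          by (rule reaches_read[of _ _ _ _ Fin Hold]) (use 0 Cons assms(1) in \<open>auto intro: transition.intros reaches_Fin\<close>)
      next
        case (Suc p')
        show ?thesis unfolding Suc \<open>a = Suc r'\<close> True
          by (rule reaches_read[of _ _ _ _ "Compare r" Down _ p'])
            (use Suc True \<open>a = Suc r'\<close> Cons assms(1) in \<open>auto intro: transition.intros simp: cell_at_def\<close>)
      qed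
    next
      case False
      show ?thesis unfolding Suc
        by (rule reaches_read[OF transition.intros(18)[OF cell_at_below]])
          (use Suc False Cons assms(1) in auto)
    qed
  qed
qed simp

text \<open>The position never falls while counting and has to end at \<open>k\<close>. Hence a
  successful count stays off the top marker, where \<open>Count\<close> has no transition.\<close>

lemma counts_le: "counts r s skip u p k \<Longrightarrow> p \<le> k"
  by (induction u arbitrary: skip p) (auto split: if_splits dest: Suc_leD)

lemma reaches_Count:
  assumes "r < m" "s < m" "set u \<subseteq> {..m}" "counts r s skip u p h"
  shows "reaches n b h (Count r s skip) u h p"
  using assms(3-)
proof (induction u arbitrary: p skip)
  case (Cons a u)
  have p: "p \<le> h" using counts_le[OF Cons.prems(2)] .
  show ?case
  proof (cases a)
    case 0
    have "reaches n b h (Compare r) u h h"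
      by (rule reaches_Compare) (use 0 Cons assms in auto)
    then have "reaches n b h (Turn r) (0 # u) h (Suc h)"
      by (intro reaches_read[of "Turn r" 0 h "Suc h" "Compare r" Down])
        (use 0 Cons assms in \<open>auto intro: transition.intros\<close>)
    moreover have "p = h" using Cons.prems 0 by simp
    ultimately show ?thesis unfolding 0
      by (intro reaches_silent[OF disjI1[OF transition.intros(14)[OF cell_at_below]]])
        (use 0 Cons assms in auto)
  next
    case (Suc r')
    show ?thesis
    proof (cases "r' = s")
      case True
      show ?thesis unfolding Suc True
        by (rule reaches_read[OF transition.intros(13)[OF cell_at_below], where k' = h and p' = "if skip then p else Suc p"])
          (use Suc True Cons assms(1,2) p in \<open>auto simp: split: if_splits\<close>)
    next
      case False
      show ?thesis unfolding Suc
        by (rule reaches_read[OF transition.intros(12)[OF cell_at_below]])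
          (use Suc False Cons assms(1,2) p in auto)
    qed
  qed
qed simp

lemma reaches_check:
  assumes "K \<in> C" "K \<noteq> []" "r < m" "set u \<subseteq> {..m}" "check K r u h"
  shows "reaches n b h (Start K) u h 0"
proof -
  obtain s d where sd: "update K r = (s, d)" by fastforce
  then have s: "s < m" using m_update[OF assms(1,3)] by simp
  show ?thesis
    by (rule reaches_silent[OF disjI1[OF transition.intros(9)[OF assms(1-3) sd, folded cell_at_eq(3)[of h]]],
          where k' = h and p' = "if d = Inc then 1 else 0"])
      (use assms s sd in \<open>auto simp: check_def intro: reaches_Count\<close>)
qed

lemma reaches_Scan:
  assumes "K \<in> C" "set u \<subseteq> {..m}" "scan m K z u h"
  shows "reaches n b h (Scan K z) u h 0"
  using assms
proof (induction u arbitrary: K z)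
  case (Cons a u)
  show ?case
  proof (cases a)
    case 0
    let ?K = "next_ctrl K z"
    have K: "?K \<in> C" "?K \<noteq> []" and or: "scan m ?K False u h \<or> (\<exists>r<m. check ?K r u h)"
      using Cons.prems C_next 0 by auto
    from or have "reaches n b h (Start ?K) u h 0"
    proof
      assume "scan m ?K False u h"
      then have "reaches n b h (Scan ?K False) u h 0" using Cons K by auto
      then show ?thesis
        by (intro reaches_silent[OF disjI1[OF transition.intros(8)[OF K, folded cell_at_eq(3)[of h]]], where k' = h and p' = 0])
          (use Cons in auto)
    qed (use Cons.prems K in \<open>auto intro: reaches_check\<close>)
    then show ?thesis unfolding 0
      by (intro reaches_read[OF transition.intros(11)[OF Cons.prems(1), folded cell_at_eq(3)[of h]], where k' = h and p' = 0])
        (use Cons in auto)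
  next
    case (Suc r)
    show ?thesis unfolding Suc
      by (intro reaches_read[OF transition.intros(10)[OF Cons.prems(1), folded cell_at_eq(3)[of h]], where k' = h and p' = 0])
        (use Cons Suc in auto)
  qed
qed simp

lemma reaches_Start:
  assumes "K \<in> C" "set u \<subseteq> {..m}" "start m K u h"
  shows "reaches n b h (Start K) u h 0"
proof (cases "scan m K False u h")
  case True
  have "K \<noteq> []" using assms by (simp add: start_def)
  with True assms show ?thesis
    by (intro reaches_silent[OF disjI1[OF transition.intros(8)[OF assms(1), folded cell_at_eq(3)[of h]]], where k' = h and p' = 0])
      (auto intro: reaches_Scan)
next
  case False
  with assms show ?thesis by (auto simp: start_def intro: reaches_check)
qed

lemma reaches_Rewind:
  assumes "set u \<subseteq> {..m}" "start m K0 u h" "p \<le> h"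
  shows "reaches n b h Rewind u h p"
  using assms(3)
proof (induction p)
  case 0
  show ?case
    by (rule reaches_silent[OF disjI1[OF transition.intros(7)[folded cell_at_eq(3)[of h]]], where k' = h and p' = 0])
      (use assms K0 in \<open>auto intro: reaches_Start\<close>)
next
  case (Suc p)
  show ?case
    by (rule reaches_silent[of _ _ _ Rewind Down h p])
      (use assms Suc in \<open>auto intro: transition.intros simp: cell_at_def\<close>)
qed

lemma reaches_Guess:
  assumes "set u \<subseteq> {..m}" "start m K0 u h" "k \<le> h"
  shows "reaches n b h Guess u k k"
  using assms(3)
proof (induction rule: inc_induct)
  case base
  show ?case
    by (rule reaches_silent[OF disjI1[OF transition.intros(5)[OF cell_at_below]]])
      (use assms in \<open>auto intro: reaches_Rewind\<close>)
next
  case (step k)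
  show ?case
    by (rule reaches_silent[OF disjI1[OF transition.intros(4)[OF cell_at_below]]])
      (use assms step in auto)
qed

text \<open>The first symbol is pushed on leaving \<open>Init\<close>, so \<open>Chain i\<close> is
  entered at height \<open>Suc i\<close>; the chain then ends at \<open>Suc n\<close>.\<close>

lemma reaches_Chain:
  assumes "set u \<subseteq> {..m}" "differs 1 u h" "h = Suc n" "i \<le> n"
  shows "reaches n b h (Chain i) u (Suc i) (Suc i)"
  using assms(4)
proof (induction rule: inc_induct)
  case base
  have tr: "chain n (Chain n) None (cell_at (Suc n) (Suc n)) (Compare 1) Stay"
    using chain.intros(2) by (simp add: cell_at_def)
  show ?case
    by (rule reaches_silent[OF disjI2[OF tr]]) (use reaches_Compare[of 1 u h] assms m_1 in auto)
next
  case (step i)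
  have tr: "chain n (Chain i) None (cell_at (Suc i) (Suc i)) (Chain (Suc i)) (Push 0)"
    using chain.intros(1)[OF step(2)] by (simp add: cell_at_def)
  show ?case
    by (rule reaches_silent[OF disjI2[OF tr]]) (use assms step in auto)
qed

lemma reaches_Init:
  assumes "set u \<subseteq> {..m}" "accepts m K0 n u h"
  shows "reaches n b h Init u 0 0"
proof -
  consider "h = Suc n" "differs 1 u h" | r where "h = 0" "r < m" "r \<noteq> 1" "differs r u 0"
    | "start m K0 u h"
    using assms(2) unfolding accepts_def by blast
  then show ?thesis
  proof cases
    case 1
    with reaches_Chain[of u 0] assms show ?thesis
      by (intro reaches_silent[OF disjI1[OF transition.intros(1)[folded cell_at_eq(3)[of 0]]]]) auto
  next
    case 2
    with reaches_Compare[of r u 0] assms show ?thesis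
      by (intro reaches_silent[OF disjI1[OF transition.intros(2)[folded cell_at_eq(3)[of 0]]]]) auto
  next
    case 3
    with assms show ?thesis
      by (intro reaches_silent[OF disjI1[OF transition.intros(3)[folded cell_at_eq(3)[of 0]]]]) (auto intro: reaches_Guess)
  qed
qed

end

end

section \<open>Histories and weak space\<close>

abbreviation ticks :: "nat list \<Rightarrow> nat \<Rightarrow> nat" where
  "ticks b \<equiv> \<lambda>r. count_list b (Suc r)"

lemma differs_block: "0 \<notin> set b \<Longrightarrow> differs r (b @ 0 # v) k \<longleftrightarrow> ticks b r \<noteq> k"
  by (induction b arbitrary: k) (auto split: nat.splits)

text \<open>The truncated subtraction is intended: skipping the first unit, if there is one,
  computes \<open>Dec\<close> correctly at \<open>0\<close> as well.\<close>

lemma counts_block: "0 \<notin> set b \<Longrightarrow> counts r s skip (b @ 0 # v) p k \<longleftrightarrow>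
    p + (ticks b s - of_bool skip) = k \<and> differs r v k"
  by (induction b arbitrary: p skip) auto

lemma check_block: "0 \<notin> set b \<Longrightarrow> check K r (b @ 0 # v) k \<longleftrightarrow>
    new_value K (ticks b) r = k \<and> differs r v k"
proof -
  assume b: "0 \<notin> set b"
  obtain s d where "update K r = (s, d)" by fastforce
  then show ?thesis by (cases d) (auto simp: check_def new_value_def counts_block[OF b])
qed

lemma scan_block: "0 \<notin> set b \<Longrightarrow> scan m K z (b @ 0 # v) k \<longleftrightarrow>
    start m (next_ctrl K (z \<or> test_value K (ticks b))) v k"
proof (induction b arbitrary: z)
  case Nil
  show ?case by (auto simp: start_def test_value_def)
next
  case (Cons a b)
  then obtain r where a: "a = Suc r" by (cases a) auto
  have "(z \<or> tests K r) \<or> test_value K (ticks b) \<longleftrightarrow> z \<or> test_value K (ticks (a # b))"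
    unfolding test_value_def a by auto
  then show ?case using Cons a by auto
qed

lemma start_block: "0 \<notin> set b \<Longrightarrow> start m K (b @ 0 # v) k \<longleftrightarrow> K \<noteq> [] \<and>
    (start m (next_ctrl K (test_value K (ticks b))) v k \<or>
      (\<exists>r<m. new_value K (ticks b) r = k \<and> differs r v k))"
  by (subst start_def) (simp add: scan_block check_block)

lemma counts_0: "counts r s skip u p k \<Longrightarrow> 0 \<in> set u"
  by (induction u arbitrary: p skip) (auto split: if_splits)

lemma scan_0: "scan m K z u k \<Longrightarrow> 0 \<in> set u"
  by (induction u arbitrary: K z) (auto split: nat.splits)

text \<open>Both ways of accepting pass a block terminator first: \<open>scan\<close> to reach the
  next control, \<open>check\<close> to confirm the guess. An unterminated tail can be refuted, but
  no check can start in it.\<close>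

lemma start_0: "start m K u k \<Longrightarrow> \<exists>b v. u = b @ 0 # v \<and> 0 \<notin> set b"
  by (rule split_list_first) (auto simp: start_def check_def dest: scan_0 counts_0)

context history_automaton
begin

lemma unary_automaton: "unary (automaton n b)"
  by (auto simp: unary_def automaton_def coded_def elim!: transition.cases chain.cases split: if_splits)

lemma accepting_computation_automaton:
  assumes "m < b"
  shows "(\<exists>cs. accepting_computation (automaton n b) u cs \<and> computation_space cs = h) \<longleftrightarrow>
    set u \<subseteq> {..m} \<and> accepts m K0 n u h"
proof -
  have "u \<in> lists {..<b}" if "set u \<subseteq> {..m}" using that assms by auto
  moreover have "(\<exists>q p. (pos_step (automaton n b))\<^sup>*\<^sup>* (st_code Init, u, 0, 0) (q, [], h, p) \<and> q = st_code Fin) \<longleftrightarrow>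
      set u \<subseteq> {..m} \<and> accepts m K0 n u h"
    using automaton_sound[of n b Init u 0 0 h] reaches_Init[OF assms, of u n h] by (auto simp: reaches_def)
  ultimately show ?thesis
    unfolding accepting_computation_pos[OF unary_automaton] by (auto simp: automaton_def)
qed

lemma weak_space_word_automaton:
  assumes "m < b"
  shows "weak_space_word (automaton n b) u =
    (if set u \<subseteq> {..m} \<and> (\<exists>h. accepts m K0 n u h) then LEAST h. accepts m K0 n u h else 0)"
proof -
  have "u \<in> language (automaton n b) \<longleftrightarrow> set u \<subseteq> {..m} \<and> (\<exists>h. accepts m K0 n u h)"
    using accepting_computation_automaton[OF assms, of n u]
    by (auto simp: language_def accepting_computation_def computation_def partial_computation_def) blast+
  then show ?thesis
    unfolding weak_space_word_def accepting_computation_automaton[OF assms] by auto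
qed

context
  fixes n :: nat
begin

definition conf :: "nat \<Rightarrow> cmd list \<times> (nat \<Rightarrow> nat)" where
  "conf t = (run_step ^^ t) (K0, (\<lambda>_. 0)(1 := Suc n))"

definition ctrl :: "nat \<Rightarrow> cmd list" where
  "ctrl t = fst (conf t)"

definition val :: "nat \<Rightarrow> nat \<Rightarrow> nat" where
  "val t = snd (conf t)"

definition block :: "nat \<Rightarrow> nat list \<Rightarrow> bool" where
  "block t b \<longleftrightarrow> 0 \<notin> set b \<and> (\<forall>r<m. ticks b r = val t r)"

lemma ctrl_0: "ctrl 0 = K0" and val_0: "val 0 = (\<lambda>_. 0)(1 := Suc n)"
  by (simp_all add: ctrl_def val_def conf_def)

lemma conf_Suc: "conf (Suc t) = (next_ctrl (ctrl t) (test_value (ctrl t) (val t)), new_value (ctrl t) (val t))"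
  unfolding ctrl_def val_def by (simp add: conf_def flip: run_step.simps)

lemma ctrl_Suc: "ctrl (Suc t) = next_ctrl (ctrl t) (test_value (ctrl t) (val t))"
  and val_Suc: "val (Suc t) = new_value (ctrl t) (val t)"
  by (simp_all add: conf_Suc ctrl_def[of "Suc t"] val_def[of "Suc t"])

lemma ctrl_C: "ctrl t \<in> C"
  by (induction t) (simp_all add: ctrl_0 ctrl_Suc K0 C_next)

text \<open>A block that agrees with configuration \<open>t\<close> below \<open>m\<close> yields
  the genuine next control and the genuine next values below \<open>m\<close>, because sources and
  tested registers lie below \<open>m\<close>.\<close>

lemma start_history:
  assumes "block t b"
  shows "start m (ctrl t) (b @ 0 # v) k \<longleftrightarrow> ctrl t \<noteq> [] \<and>
    (start m (ctrl (Suc t)) v k \<or> (\<exists>r<m. val (Suc t) r = k \<and> differs r v k))"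
proof -
  have "new_value (ctrl t) (ticks b) r = val (Suc t) r" if "r < m" for r
    using assms m_update[OF ctrl_C that] by (simp add: val_Suc new_value_def block_def)
  moreover have "test_value (ctrl t) (ticks b) = test_value (ctrl t) (val t)"
    using assms m_tests[OF ctrl_C] by (auto simp: test_value_def block_def)
  ultimately show ?thesis using assms by (auto simp: start_block block_def ctrl_Suc)
qed

text \<open>The accepting height is the correct value, not the one found in the word. However large
  the wrong entry is, it is refuted with a stack bounded by the genuine run.\<close>

lemma not_block_differs:
  assumes "0 \<notin> set b" "\<not> block t b"
  shows "\<exists>r<m. differs r (b @ 0 # v) (val t r)"
  using assms by (auto simp: block_def differs_block)

text \<open>
  If the run halts, a word that is accepted at all has a first error, and that error lies in the
  finitely many genuine configurations of the run, so it can be exhibited with a bounded stack.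
\<close>

lemma start_bounded:
  assumes T: "ctrl T = []" and V: "\<And>t r. t \<le> T \<Longrightarrow> r < m \<Longrightarrow> val t r \<le> V"
    and "t \<le> T" "start m (ctrl t) (b @ 0 # v) k" "block t b"
  shows "\<exists>k'\<le>V. start m (ctrl t) (b @ 0 # v) k'"
  using assms(3-)
proof (induction arbitrary: b v rule: inc_induct)
  case base
  then show ?case using T by (simp add: start_def)
next
  case (step t)
  note iff = start_history[OF step.prems(2)]
  from step.prems(1)[unfolded iff] have ne: "ctrl t \<noteq> []"
    and or: "start m (ctrl (Suc t)) v k \<or> (\<exists>r<m. val (Suc t) r = k \<and> differs r v k)" by auto
  have "\<exists>k'\<le>V. start m (ctrl (Suc t)) v k' \<or> (\<exists>r<m. val (Suc t) r = k' \<and> differs r v k')"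
    using or
  proof
    assume st: "start m (ctrl (Suc t)) v k"
    from start_0[OF st] obtain b' v' where v: "v = b' @ 0 # v'" "0 \<notin> set b'" by blast
    show ?thesis
    proof (cases "block (Suc t) b'")
      case True
      from step.IH[OF st[unfolded v(1)] True] show ?thesis unfolding v(1) by blast
    next
      case False
      from not_block_differs[OF v(2) False] obtain r where "r < m" "differs r v (val (Suc t) r)"
        unfolding v(1) by blast
      with V[of "Suc t" r] step.hyps show ?thesis by auto
    qed
  qed (use V[of "Suc t"] step.hyps in auto)
  then show ?case unfolding iff using ne by blast
qed

text \<open>The first block has no predecessor, so its errors are refuted at the initial values
  \<open>Suc n\<close> and \<open>0\<close>; a correct first block reduces the claim to
  \<open>start_bounded\<close>.\<close>

lemma accepts_bounded:
  assumes T: "ctrl T = []" and V: "\<And>t r. t \<le> T \<Longrightarrow> r < m \<Longrightarrow> val t r \<le> V"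
    and acc: "accepts m K0 n u k"
  shows "\<exists>k'\<le>V. accepts m K0 n u k'"
proof -
  have n: "Suc n \<le> V" using V[of 0 1] m_1 by (simp add: val_0)
  consider "k \<le> V" | "start m K0 u k" using acc n unfolding accepts_def by force
  then show ?thesis
  proof cases
    case 2
    from start_0[OF 2] obtain b v where u: "u = b @ 0 # v" "0 \<notin> set b" by blast
    show ?thesis
    proof (cases "block 0 b")
      case True
      then show ?thesis
        using start_bounded[OF T V, of 0 b v k] 2 unfolding ctrl_0 u(1) accepts_def by blast
    next
      case False
      from not_block_differs[OF u(2) False] obtain r where r: "r < m" "differs r u (val 0 r)"
        unfolding u(1) by blast
      then have "accepts m K0 n u (val 0 r)" by (auto simp: accepts_def val_0 split: if_splits)
      with r V[of 0 r] show ?thesis by auto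
    qed
  qed (use acc in blast)
qed

section \<open>Words that force a large stack\<close>

definition canonical_block :: "nat \<Rightarrow> nat list" where
  "canonical_block t = concat (map (\<lambda>r. replicate (val t r) (Suc r)) [0..<m])"

lemma block_canonical: "block t (canonical_block t)"
proof -
  have replicate: "count_list (replicate k x) x = k" for k and x :: nat
    by (induction k) auto
  have "count_list (concat (map (\<lambda>r. replicate (f r) (Suc r)) [0..<l])) (Suc r) = (if r < l then f r else 0)"
    for f l r
    by (induction l) (auto simp: count_list_0_iff replicate less_Suc_eq)
  moreover have "0 \<notin> set (canonical_block t)" by (auto simp: canonical_block_def)
  ultimately show ?thesis by (simp add: block_def canonical_block_def)
qed

text \<open>
  In \<open>history d t\<close> the only error is the clock of the last block.
\<close>

fun history :: "nat \<Rightarrow> nat \<Rightarrow> nat list" where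
  "history 0 t = (1 # canonical_block t) @ [0]"
| "history (Suc d) t = canonical_block t @ 0 # history d (Suc t)"

lemma val_clock: "val t 0 = t"
proof (induction t)
  case (Suc t)
  have "update K 0 = (0, Inc)" for K by (induction K "0 :: nat" rule: update.induct) auto
  with Suc show ?case by (simp add: val_Suc new_value_def)
qed (simp add: val_0)

lemma set_history: "set (history d t) \<subseteq> {..m}"
  by (induction d arbitrary: t) (use m_1 in \<open>auto simp: canonical_block_def\<close>)

lemma length_history: "d \<le> length (history d t)"
  by (induction d arbitrary: t) (auto simp: le_SucI trans_le_add2)

lemma differs_history:
  assumes "r < m"
  shows "differs r (history d t) (val t r) \<longleftrightarrow> d = 0 \<and> r = 0"
proof (cases d)
  case 0
  have "0 \<notin> set (1 # canonical_block t)" using block_canonical[of t] by (simp add: block_def)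
  from differs_block[OF this, of r "[]" "val t r"] show ?thesis
    using 0 assms block_canonical[of t] by (auto simp: block_def)
next
  case (Suc d')
  then show ?thesis
    using assms block_canonical[of t] by (auto simp: block_def differs_block)
qed

text \<open>Every block but the last is genuine, so only the comparison with the last one can
  succeed, and only on the clock, whose correct value there is \<open>Suc (d + t)\<close>. The
  accepting height is unique, so taking the minimum does not help.\<close>

lemma start_history_iff:
  assumes "\<And>t. ctrl t \<noteq> []"
  shows "start m (ctrl t) (history (Suc d) t) k \<longleftrightarrow> k = Suc (d + t)"
proof (induction d arbitrary: t)
  case 0
  \<comment> \<open>The wrong block is the last one: nothing follows it that could be compared with
    values computed from it.\<close>
  have "\<not> start m K (history 0 t) k" for K t
  proof -
    have "0 \<notin> set (1 # canonical_block t)" using block_canonical[of t] by (simp add: block_def)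
    from start_block[OF this, of m K "[]" k] show ?thesis by (auto simp: start_def check_def split: prod.splits)
  qed
  moreover have "(\<exists>r<m. val (Suc t) r = k \<and> differs r (history 0 (Suc t)) k) \<longleftrightarrow> k = Suc t"
    using differs_history[of _ 0 "Suc t"] differs_history[of 0 0 "Suc t"] m_1 val_clock[of "Suc t"]
    by (auto intro!: exI[of _ 0] simp del: history.simps)
  ultimately show ?case
    unfolding history.simps(2)[of 0] start_history[OF block_canonical] using assms by auto
next
  case (Suc d)
  show ?case
    unfolding history.simps(2)[of "Suc d"] start_history[OF block_canonical] Suc
    using assms differs_history[of _ "Suc d" "Suc t"] by auto
qed

lemma accepts_history:
  assumes "\<And>t. ctrl t \<noteq> []"
  shows "accepts m K0 n (history (Suc d) 0) k \<longleftrightarrow> k = Suc d"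
proof -
  have "\<not> differs 1 (history (Suc d) 0) (Suc n)"
    using differs_history[of 1 "Suc d" 0] m_1 by (simp add: val_0 del: history.simps)
  moreover have "\<not> differs r (history (Suc d) 0) 0" if "r < m" "r \<noteq> 1" for r
    using differs_history[of r "Suc d" 0] that by (simp add: val_0 del: history.simps)
  ultimately show ?thesis
    unfolding accepts_def using start_history_iff[OF assms, of 0 d k]
    by (auto simp: ctrl_0 simp del: history.simps)
qed

lemma weak_space_bounded_iff:
  assumes b: "m < b"
  shows "(\<lambda>l. real (weak_space (automaton n b) l)) \<in> O(\<lambda>_. 1) \<longleftrightarrow> (\<exists>t. ctrl t = [])"
proof -
  let ?W = "\<lambda>l. {u \<in> lists (sa_inputs (automaton n b)). length u = l}"
  have fin: "finite (?W l)" for l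
    using finite_lists_length_eq[of "{..<b}" l] by (simp add: automaton_def lists_eq_set)
  show ?thesis
  proof
    assume "\<exists>t. ctrl t = []"
    then obtain T where T: "ctrl T = []" by blast
    define V where "V = (\<Sum>t\<le>T. \<Sum>r<m. val t r)"
    have V: "val t r \<le> V" if "t \<le> T" "r < m" for t r
    proof -
      have "val t r \<le> (\<Sum>r<m. val t r)" using that by (intro member_le_sum) auto
      also have "\<dots> \<le> V" unfolding V_def using that by (intro member_le_sum) auto
      finally show ?thesis .
    qed
    have "(LEAST h. accepts m K0 n u h) \<le> V" if "accepts m K0 n u h" for u h
      using accepts_bounded[OF T V that] by (meson Least_le order_trans)
    then have word: "weak_space_word (automaton n b) u \<le> V" for u
      unfolding weak_space_word_automaton[OF b] by auto
    have "weak_space (automaton n b) l \<le> V" for l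
    proof (cases "?W l = {}")
      case True
      then show ?thesis unfolding weak_space_def True by simp
    next
      case False
      then show ?thesis unfolding weak_space_def by (intro cSUP_least word)
    qed
    then show "(\<lambda>l. real (weak_space (automaton n b) l)) \<in> O(\<lambda>_. 1)"
      by (intro landau_o.bigI[of "real V + 1"] always_eventually allI)
        (auto intro: order_trans[of _ "real V"])
  next
    assume O: "(\<lambda>l. real (weak_space (automaton n b) l)) \<in> O(\<lambda>_. 1)"
    then obtain c where "eventually (\<lambda>l. norm (real (weak_space (automaton n b) l)) \<le> c * norm (1::real)) at_top"
      by (elim landau_o.bigE)
    then obtain N where N: "\<And>l. l \<ge> N \<Longrightarrow> real (weak_space (automaton n b) l) \<le> c"
      by (auto simp: eventually_at_top_linorder)
    show "\<exists>t. ctrl t = []"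
    proof (rule ccontr)
      assume "\<nexists>t. ctrl t = []"
      then have ne: "\<And>t. ctrl t \<noteq> []" by blast
      \<comment> \<open>The word must be longer than \<open>N\<close> for the bound to apply, and
        the height \<open>Suc d\<close> that it forces must exceed \<open>c\<close>.\<close>
      define d where "d = max N (nat \<lceil>c\<rceil>)"
      define u where "u = history (Suc d) 0"
      have acc: "accepts m K0 n u k \<longleftrightarrow> k = Suc d" for k
        unfolding u_def by (rule accepts_history[OF ne])
      have u: "set u \<subseteq> {..m}" unfolding u_def by (rule set_history)
      have "weak_space_word (automaton n b) u = Suc d"
        unfolding weak_space_word_automaton[OF b] acc using u by (auto intro: Least_equality)
      moreover have "u \<in> ?W (length u)" using u b by (auto simp: automaton_def)
      then have "weak_space_word (automaton n b) u \<le> weak_space (automaton n b) (length u)"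
        unfolding weak_space_def by (intro cSUP_upper bdd_above_finite finite_imageI fin)
      moreover have "N \<le> length u"
        using length_history[of "Suc d" 0] unfolding u_def d_def by linarith
      ultimately have "real (Suc d) \<le> c" using N by (metis of_nat_le_iff order_trans)
      then show False unfolding d_def by linarith
    qed
  qed
qed

end

end

section \<open>The diagonal argument\<close>

text \<open>A finite set closed under \<open>next_ctrl\<close>: unfolding a loop only puts
  remainders of its body in front of that same loop, and the empty remainder gives back the loop
  itself.\<close>

fun ctrls :: "cmd list \<Rightarrow> cmd list set" where
  "ctrls [] = {[]}"
| "ctrls (Asg r s d # K) = insert (Asg r s d # K) (ctrls K)"
| "ctrls (Loop r c # K) = ctrls K \<union> (\<lambda>c'. c' @ Loop r c # K) ` ctrls c"

lemma finite_ctrls: "finite (ctrls K)"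
  by (induction K rule: ctrls.induct) auto

lemma Nil_in_ctrls: "[] \<in> ctrls K"
  by (induction K rule: ctrls.induct) auto

lemma self_in_ctrls: "K \<in> ctrls K"
  by (cases K rule: ctrls.cases) (auto intro: Nil_in_ctrls)

lemma next_ctrl_append: "c \<noteq> [] \<Longrightarrow> next_ctrl (c @ K) z = next_ctrl c z @ K"
  by (cases c rule: ctrls.cases) auto

lemma ctrls_closed: "K' \<in> ctrls K \<Longrightarrow> next_ctrl K' z \<in> ctrls K"
proof (induction K arbitrary: K' rule: ctrls.induct)
  case (2 r s d K)
  then show ?case by (auto intro: self_in_ctrls)
next
  case (3 r c K)
  from 3(3) consider "K' \<in> ctrls K" | c' where "K' = c' @ Loop r c # K" "c' \<in> ctrls c" by auto
  then show ?case
  proof cases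
    case 1
    with 3 show ?thesis by auto
  next
    case 2
    show ?thesis
    proof (cases "c' = []")
      case True
      with 2 show ?thesis by (auto intro: self_in_ctrls)
    next
      case False
      with 2 3(2)[OF 2(2)] show ?thesis by (auto simp: next_ctrl_append)
    qed
  qed
qed simp

lemma history_automaton_exists: "\<exists>m. history_automaton K (ctrls K) m"
proof -
  \<comment> \<open>Apart from the clock and the updated register itself, this is the only register
    that \<open>update\<close> or \<open>tests\<close> can refer to. The bound \<open>m + 2\<close>
    leaves room for registers \<open>0\<close> and \<open>1\<close>.\<close>
  define src :: "cmd list \<Rightarrow> nat" where
    "src K = (case K of Asg r s d # _ \<Rightarrow> s | Loop r c # _ \<Rightarrow> r | [] \<Rightarrow> 0)" for K
  obtain m where m: "\<forall>s \<in> src ` ctrls K. s < m"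
    using finite_ctrls finite_nat_set_iff_bounded by blast
  have "fst (update K' r) < m + 2" if "K' \<in> ctrls K" "r < m + 2" for K' r
    using that m by (cases K' rule: ctrls.cases) (fastforce simp: src_def)+
  moreover have "r < m + 2" if "K' \<in> ctrls K" "tests K' r" for K' r
    using that m by (cases K' rule: ctrls.cases) (fastforce simp: src_def)+
  ultimately have "history_automaton K (ctrls K) (m + 2)"
    by unfold_locales (auto simp: finite_ctrls self_in_ctrls ctrls_closed)
  then show ?thesis by blast
qed

section \<open>The code of the automaton as a function of the program number\<close>

lemma le_list_encode: "x \<in> set xs \<Longrightarrow> x \<le> list_encode xs"
proof (induction xs)
  case (Cons a xs)
  then have "x \<le> a \<or> x \<le> list_encode xs" by auto
  then show ?case
    using le_prod_encode_1[of a "list_encode xs"] le_prod_encode_2[of "list_encode xs" a] by auto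
qed simp

lemma less_set_encode: "finite A \<Longrightarrow> x \<in> A \<Longrightarrow> x < set_encode A"
proof -
  assume "finite A" "x \<in> A"
  then have "2 ^ x \<le> set_encode A" unfolding set_encode_def by (intro member_le_sum) auto
  then show ?thesis using less_exp[of x] by linarith
qed

context history_automaton
begin

definition used_states :: "st set" where
  "used_states = {Init, Chain 0, Guess, Rewind, Fin} \<union> Start ` C \<union> case_prod Scan ` (C \<times> UNIV) \<union>
     (\<lambda>(r, s, z). Count r s z) ` ({..<m} \<times> {..<m} \<times> UNIV) \<union> Turn ` {..<m} \<union> Compare ` {..<m}"

lemma finite_coded_transition: "finite (coded transition)"
proof (rule finite_subset)
  have "s \<in> used_states \<and> s' \<in> used_states \<and> a \<in> insert None (Some ` {..m}) \<and> y \<in> {Bot, Top, Sym 0} \<and>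
      \<iota> \<in> {Stay, Push 0, Down, Hold, Up}" if "transition s a y s' \<iota>" for s a y s' \<iota>
    using that
  proof cases
    case (9 K r s d)
    then have "s < m" using m_update[of K r] by simp
    with 9 show ?thesis by (auto simp: used_states_def image_iff)
  qed (use K0 C_next m_1 in \<open>auto simp: used_states_def image_iff\<close>)
  then show "coded transition \<subseteq> st_code ` used_states \<times> insert None (Some ` {..m}) \<times> {Bot, Top, Sym 0} \<times>
      st_code ` used_states \<times> {Stay, Push 0, Down, Hold, Up}"
    by (fastforce simp: coded_def)
  show "finite (st_code ` used_states \<times> insert None (Some ` {..m}) \<times> ({Bot, Top, Sym 0} :: nat cell set) \<times>
      st_code ` used_states \<times> ({Stay, Push 0, Down, Hold, Up} :: nat instr set))"
    using finite_C by (auto simp: used_states_def)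
qed

text \<open>
  The number of the program \<open>K0\<close> in the diagonal argument. Using the transitions themselves as the
  program text makes the code of the automaton easily computable from it, and it exceeds all
  state numbers.
\<close>

definition core_code :: nat where
  "core_code = set_encode (transition_code ` coded transition)"

lemma transition_less_core_code:
  assumes "transition s a y s' \<iota>"
  shows "st_code s < core_code \<and> st_code s' < core_code \<and> option_code a < core_code"
proof -
  let ?t = "(st_code s, a, y, st_code s', \<iota>)"
  have "?t \<in> coded transition" using assms by (auto simp: coded_def)
  then have "transition_code ?t < core_code"
    unfolding core_code_def by (intro less_set_encode imageI finite_imageI finite_coded_transition)
  moreover have "x \<le> transition_code ?t" if "x \<in> {st_code s, st_code s', option_code a}" for x
    using that unfolding transition_code.simps by (intro le_list_encode) auto
  ultimately show ?thesis by (meson insertCI le_less_trans)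
qed

lemma m_less_core_code: "m < core_code" "st_code Fin < core_code"
  \<comment> \<open>\<open>Fin\<close> reads the largest letter \<open>m\<close>, so
    \<open>Suc m\<close> is an entry of a transition code.\<close>
  using transition_less_core_code[OF transition.intros(20)[of Bot m]] by auto

lemma st_code_less_core_code: "st_code Init < core_code" "st_code (Compare 1) < core_code"
  using transition_less_core_code[OF transition.intros(3)] transition_less_core_code[OF transition.intros(19)[OF m_1]] by auto

text \<open>Doubling is written \<open>i + i\<close> because addition is the arithmetic operation
  shown recursive above.\<close>

lemma coded_chain:
  "coded (chain n) = (\<lambda>i. (i + i, None, Sym 0, i + i + 2, Push 0)) ` {..<n} \<union>
     {(n + n, None, Sym 0, st_code (Compare 1), Stay)}"
proof -
  have "coded (chain n) =
      (\<lambda>i. (st_code (Chain i), None, Sym 0, st_code (Chain (Suc i)), Push 0)) ` {..<n} \<union>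
      {(st_code (Chain n), None, Sym 0, st_code (Compare 1), Stay)}"
    by (auto simp: coded_def chain.simps)
  then show ?thesis by (simp add: st_code.simps(1) mult_2)
qed

lemma stack_automaton_automaton:
  assumes "core_code \<le> b" "2 * n < b"
  shows "stack_automaton (automaton n b)"
proof -
  let ?D = "coded transition \<union> coded (chain n)"
  have "?D \<subseteq> {..<b} \<times> ({None} \<union> Some ` {..<b}) \<times> ({Bot, Top} \<union> Sym ` {0}) \<times> {..<b} \<times>
      ({Stay, Pop, Down, Hold, Up} \<union> Push ` {0})"
  proof
    fix t assume t: "t \<in> ?D"
    obtain q a y p \<iota> where eq: "t = (q, a, y, p, \<iota>)" by (cases t)
    from t have less: "q < b \<and> option_code a \<le> b \<and> p < b"
    proof
      assume "t \<in> coded transition"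
      then obtain s s' where "q = st_code s" "p = st_code s'" "transition s a y s' \<iota>"
        by (auto simp: coded_def eq)
      then show ?thesis using assms(1) transition_less_core_code by fastforce
    next
      assume "t \<in> coded (chain n)"
      then show ?thesis using assms st_code_less_core_code unfolding coded_chain eq by auto
    qed
    moreover from less have "a \<in> {None} \<union> Some ` {..<b}" by (cases a) auto
    moreover have "y \<in> {Bot, Top} \<union> Sym ` {0}"
      using t by (auto simp: eq coded_def elim!: transition.cases chain.cases)
    moreover have "\<iota> \<in> {Stay, Pop, Down, Hold, Up} \<union> Push ` {0}"
      using t by (auto simp: eq coded_def elim!: transition.cases chain.cases split: if_splits)
    ultimately show "t \<in> {..<b} \<times> ({None} \<union> Some ` {..<b}) \<times> ({Bot, Top} \<union> Sym ` {0}) \<times> {..<b} \<times>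
        ({Stay, Pop, Down, Hold, Up} \<union> Push ` {0})" unfolding eq by blast
  qed
  then show ?thesis
    using assms(1) m_less_core_code st_code_less_core_code
    by (simp add: stack_automaton_def automaton_def cells_def instrs_def)
qed

lemma checking_stack_automaton_automaton:
  assumes "core_code \<le> b" "2 * n < b"
  shows "checking_stack_automaton (automaton n b)"
proof -
  \<comment> \<open>These are the states in which the stack is still being built; every other state,
    \<open>Fin\<close> included, only reads.\<close>
  define W where "W = {Init, Guess} \<union> range Chain"
  define Qw where "Qw = st_code ` W \<inter> {..<b}"
  have code_Qw: "st_code s \<in> Qw \<longleftrightarrow> s \<in> W \<and> st_code s < b" for s
    by (auto simp: Qw_def)
  have Fin: "Fin \<notin> W" by (auto simp: W_def)
  have tr: "(s \<in> W \<longrightarrow> write_instr \<iota>) \<and> (s \<notin> W \<longrightarrow> read_instr \<iota> \<and> s' \<notin> W)"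
    if "transition s a y s' \<iota> \<or> chain n s a y s' \<iota>" for s a y s' \<iota>
    using that by (auto simp: W_def write_instr_def read_instr_def elim!: transition.cases chain.cases split: if_splits)
  have part: "(q \<in> Qw \<longrightarrow> write_instr \<iota>) \<and> (q \<in> {..<b} - Qw \<longrightarrow> read_instr \<iota> \<and> p \<notin> Qw)"
    if "(q, a, y, p, \<iota>) \<in> sa_delta (automaton n b)" for q a y p \<iota>
  proof -
    from that obtain s s' where s: "q = st_code s" "p = st_code s'"
      "transition s a y s' \<iota> \<or> chain n s a y s' \<iota>"
      by (auto simp: automaton_def coded_def)
    from tr[OF s(3)] show ?thesis unfolding s(1,2) Diff_iff code_Qw lessThan_iff by blast
  qed
  have "non_erasing (automaton n b)"
    using unary_automaton by (fastforce simp: unary_def non_erasing_def)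
  moreover have "state_partition (automaton n b) Qw ({..<b} - Qw)"
  proof -
    have "sa_states (automaton n b) = Qw \<union> ({..<b} - Qw)"
      by (auto simp: automaton_def Qw_def)
    moreover have "sa_finals (automaton n b) \<subseteq> {..<b} - Qw"
      using Fin assms m_less_core_code by (auto simp: automaton_def code_Qw)
    moreover have "\<forall>(q, a, y, p, \<iota>) \<in> sa_delta (automaton n b).
        (q \<in> Qw \<longrightarrow> write_instr \<iota>) \<and> (q \<in> {..<b} - Qw \<longrightarrow> read_instr \<iota>)"
      using part by blast
    ultimately show ?thesis unfolding state_partition_def by blast
  qed
  moreover have "\<forall>(q, a, y, p, \<iota>) \<in> sa_delta (automaton n b). \<not> (q \<in> {..<b} - Qw \<and> p \<in> Qw)"
    using part by blast
  ultimately show ?thesis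
    using stack_automaton_automaton[OF assms] unfolding checking_stack_automaton_def by blast
qed

text \<open>Set codes add up on disjoint sets, and no core transition leaves a \<open>Chain\<close>
  state, so \<open>core_code\<close> survives as a summand. The remaining terms depend only on
  \<open>n\<close>, \<open>b\<close> and three state numbers that are the same for all programs. In
  the inner lists \<open>0, 2\<close> codes \<open>None, Sym 0\<close>, and the last entry
  \<open>5\<close> or \<open>0\<close> codes \<open>Push 0\<close> or \<open>Stay\<close>.\<close>

lemma sa_code_automaton:
  "sa_code (automaton n b) = list_encode
    [\<Sum>i<b. 2 ^ i, \<Sum>i<b. 2 ^ i, 1,
     core_code + (\<Sum>i<n. 2 ^ list_encode [i + i, 0, 2, i + i + 2, 5]) +
       2 ^ list_encode [n + n, 0, 2, st_code (Compare 1), 0],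
     st_code Init, 2 ^ st_code Fin]"
proof -
  let ?w = "\<lambda>t. 2 ^ transition_code t :: nat"
  let ?c = "\<lambda>i :: nat. (i + i, None, Sym 0, i + i + 2, Push 0) :: nat \<times> nat option \<times> nat cell \<times> nat \<times> nat instr"
  let ?e = "(n + n, None, Sym 0, st_code (Compare 1), Stay) :: nat \<times> nat option \<times> nat cell \<times> nat \<times> nat instr"
  have set_encode_sum: "set_encode (transition_code ` A) = sum ?w A" for A
    unfolding set_encode_def by (subst sum.reindex) (auto intro: inj_on_subset[OF inj_transition_code])
  have no_chain: "\<not> transition (Chain i) a y s' \<iota>" for i a y s' \<iota>
    by (auto elim: transition.cases)
  have "(i + i, a, y, p, \<iota>) \<notin> coded transition" for i a y p \<iota>
  proof
    assume "(i + i, a, y, p, \<iota>) \<in> coded transition"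
    then obtain s s' where s: "st_code (Chain i) = st_code s" "transition s a y s' \<iota>"
      by (auto simp: coded_def st_code.simps(1) mult_2)
    then show False using no_chain by (metis st_code_eq)
  qed
  then have "coded transition \<inter> coded (chain n) = {}" unfolding coded_chain by blast
  then have "sum ?w (coded transition \<union> coded (chain n)) = sum ?w (coded transition) + sum ?w (coded (chain n))"
    using finite_coded_transition by (intro sum.union_disjoint) (simp_all add: coded_chain)
  also have "sum ?w (coded (chain n)) = sum ?w (?c ` {..<n}) + ?w ?e"
    unfolding coded_chain by (subst sum.union_disjoint) auto
  also have "sum ?w (?c ` {..<n}) = (\<Sum>i<n. 2 ^ list_encode [i + i, 0, 2, i + i + 2, 5])"
  proof -
    have "sum ?w (?c ` {..<n}) = (\<Sum>i<n. ?w (?c i))"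
      by (intro sum.reindex_cong[where l = ?c]) (auto simp: inj_on_def)
    then show ?thesis
      by (simp only: transition_code.simps option_code.simps cell_code.simps instr_code.simps add_0)
  qed
  also have "?w ?e = 2 ^ list_encode [n + n, 0, 2, st_code (Compare 1), 0]"
    by (simp only: transition_code.simps option_code.simps cell_code.simps instr_code.simps add_0)
  finally have delta: "sum ?w (coded transition \<union> coded (chain n)) = sum ?w (coded transition) +
      ((\<Sum>i<n. 2 ^ list_encode [i + i, 0, 2, i + i + 2, 5]) +
       2 ^ list_encode [n + n, 0, 2, st_code (Compare 1), 0])" .
  have "set_encode {..<b} = (\<Sum>i<b. 2 ^ i)" "set_encode {0} = 1" "set_encode {x} = 2 ^ x" for x
    by (simp_all add: set_encode_def)
  then show ?thesis
    by (simp only: sa_code_def automaton_def sa.select_convs core_code_def set_encode_sum delta add.assoc)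
qed

end

section \<open>Behaviour of the diagonal program\<close>

lemma funpow_run_step_Nil: "fst ((run_step ^^ t) ([], x)) = []"
proof -
  have "fst (run_step c) = []" if "fst c = []" for c using that by (cases c) simp
  then show ?thesis by (induction t) auto
qed

lemma diverges:
  assumes "x 2 \<noteq> 0"
  shows "fst ((run_step ^^ t) ([Loop 2 [Asg 2 2 Inc]], x)) \<noteq> []"
proof -
  let ?L = "Loop 2 [Asg 2 2 Inc]"
  let ?P = "\<lambda>c. fst c = [?L] \<and> snd c 2 \<noteq> 0 \<or> fst c = [Asg 2 2 Inc, ?L]"
  have "?P (run_step c)" if "?P c" for c
    using that by (cases c) (auto simp: test_value_def new_value_def)
  then have "?P ((run_step ^^ t) ([?L], x))" using assms by (induction t) auto
  then show ?thesis by auto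
qed

lemma runs_final_Nil:
  assumes "runs c ([], x)" "runs c ([Loop 2 [Asg 2 2 Inc]], y)" "y 2 \<noteq> 0"
  shows False
proof -
  let ?L = "Loop 2 [Asg 2 2 Inc]"
  obtain s t where s: "(run_step ^^ s) c = ([], x)" and t: "(run_step ^^ t) c = ([?L], y)"
    using assms(1,2) unfolding runs_def by blast
  show False
  proof (cases "s \<le> t")
    case True
    then obtain d where "t = d + s" using le_iff_add by (metis add.commute)
    then show False using s t funpow_run_step_Nil[of d x] by (simp add: funpow_add)
  next
    case False
    then obtain d where "s = d + t" by (metis add.commute le_iff_add nat_le_linear)
    then show False using s t diverges[of y d, OF assms(3)] by (simp add: funpow_add)
  qed
qed

text \<open>The chain checks the initial value \<open>Suc e\<close>, so the leading
  \<open>Dec\<close> restores the argument \<open>e\<close>. Register \<open>2\<close> receives the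
  answer of \<open>g\<close>; the final loop is left at once if it is \<open>0\<close>, and
  otherwise increments it forever.\<close>

lemma diagonal_halts_iff:
  assumes "computes g [e] v"
  shows "(\<exists>x. runs (Asg 1 1 Dec # compile g [1] 2 3 @ [Loop 2 [Asg 2 2 Inc]], (\<lambda>_. 0)(1 := Suc e)) ([], x)) \<longleftrightarrow> v = 0"
proof -
  let ?L = "Loop 2 [Asg 2 2 Inc]"
  let ?c = "(Asg 1 1 Dec # compile g [1] 2 3 @ [?L], (\<lambda>_. 0)(1 := Suc e))"
  obtain x1 where x1: "runs ?c (compile g [1] 2 3 @ [?L], x1)" "x1 1 = e"
    using runs_Asg[of 1 1 Dec "compile g [1] 2 3 @ [?L]" "(\<lambda>_. 0)(1 := Suc e)"] by auto
  have "computes g (map x1 [1]) v" using assms x1(2) by simp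
  then obtain x2 where x2: "runs (compile g [1] 2 3 @ [?L], x1) ([?L], x2)" "x2 2 = v"
    by (rule compiledD[OF compiled _ refl, of g x1 "[1]" v 3 2 "[?L]"]) auto
  have r: "runs ?c ([?L], x2)" using runs_trans[OF x1(1) x2(1)] .
  show ?thesis
  proof (cases "v = 0")
    case True
    then obtain x3 where "runs ([?L], x2) ([], x3)" using runs_Loop_0[of x2 2 "[Asg 2 2 Inc]" "[]"] x2 by auto
    with r True show ?thesis using runs_trans by blast
  next
    case False
    then show ?thesis using runs_final_Nil[OF _ r] x2(2) by auto
  qed
qed

text \<open>The summation index is written \<open>(i # xs) ! 0\<close> to match the form
  \<open>f (i # xs)\<close> in \<open>recursive_sum\<close>; \<open>c1\<close>, \<open>c2\<close>,
  \<open>c3\<close> stand for the three state numbers.\<close>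

lemma recursive_sa_code: "recursive 1 (\<lambda>xs. list_encode
   [\<Sum>i<Suc 0 + (xs ! 0 + xs ! 0). 2 ^ ((i # xs) ! 0), \<Sum>i<Suc 0 + (xs ! 0 + xs ! 0). 2 ^ ((i # xs) ! 0), 1,
    xs ! 0 + (\<Sum>i<xs ! 0. 2 ^ list_encode [(i # xs) ! 0 + (i # xs) ! 0, 0, 2, (i # xs) ! 0 + (i # xs) ! 0 + 2, 5]) +
     2 ^ list_encode [xs ! 0 + xs ! 0, 0, 2, c1, 0], c2, 2 ^ c3])"
  by (intro recursive_list_encode_Cons recursive_list_encode_Nil recursive_add recursive_sum recursive_power2)
    (intro recursive_const recursive_proj; simp)+

theorem proposition16:
  shows "\<not> decidable_problem {M :: (nat, nat, nat) sa. checking_stack_automaton M} sa_code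
           (\<lambda>M. (\<lambda>n. real (weak_space M n)) \<in> O(\<lambda>_. 1))"
proof
  let ?P = "\<lambda>M :: (nat, nat, nat) sa. (\<lambda>n. real (weak_space M n)) \<in> O(\<lambda>_. 1)"
  assume "decidable_problem {M :: (nat, nat, nat) sa. checking_stack_automaton M} sa_code ?P"
  then obtain f where f: "\<And>M :: (nat, nat, nat) sa. checking_stack_automaton M \<Longrightarrow>
      computes f [sa_code M] (if ?P M then 1 else 0)"
    unfolding decidable_problem_def by auto
  obtain c where c: "\<And>e. computes c [e] (list_encode
      [\<Sum>i<Suc (2 * e). 2 ^ i, \<Sum>i<Suc (2 * e). 2 ^ i, 1,
       e + (\<Sum>i<e. 2 ^ list_encode [i + i, 0, 2, i + i + 2, 5]) +
         2 ^ list_encode [e + e, 0, 2, st_code (Compare 1), 0],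
       st_code Init, 2 ^ st_code Fin])"
  proof -
    from recursive_sa_code[of "st_code (Compare 1)" "st_code Init" "st_code Fin"]
    obtain c where c: "\<And>xs. length xs = 1 \<Longrightarrow> computes c xs (list_encode
      [\<Sum>i<Suc 0 + (xs ! 0 + xs ! 0). 2 ^ ((i # xs) ! 0), \<Sum>i<Suc 0 + (xs ! 0 + xs ! 0). 2 ^ ((i # xs) ! 0), 1,
      xs ! 0 + (\<Sum>i<xs ! 0. 2 ^ list_encode [(i # xs) ! 0 + (i # xs) ! 0, 0, 2, (i # xs) ! 0 + (i # xs) ! 0 + 2, 5]) +
      2 ^ list_encode [xs ! 0 + xs ! 0, 0, 2, st_code (Compare 1), 0], st_code Init, 2 ^ st_code Fin])"
      unfolding recursive_def by blast
    show thesis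
    proof (rule that)
      fix e
      show "computes c [e] (list_encode
        [\<Sum>i<Suc (2 * e). 2 ^ i, \<Sum>i<Suc (2 * e). 2 ^ i, 1,
         e + (\<Sum>i<e. 2 ^ list_encode [i + i, 0, 2, i + i + 2, 5]) +
           2 ^ list_encode [e + e, 0, 2, st_code (Compare 1), 0],
         st_code Init, 2 ^ st_code Fin])"
        using c[of "[e]"] by (simp add: mult_2 del: list_encode.simps sum.lessThan_Suc)
    qed
  qed
  \<comment> \<open>Both \<open>f\<close> and \<open>c\<close> are fixed before any program number
    is chosen, and \<open>K\<close> receives its number as input. The number
    \<open>core_code\<close> is determined only afterwards by \<open>K\<close>, so no fixed-point
    theorem is needed.\<close>
  define g where "g = Comp f [c]"
  define K where "K = Asg 1 1 Dec # compile g [1] 2 3 @ [Loop 2 [Asg 2 2 Inc]]"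
  obtain m where "history_automaton K (ctrls K) m" using history_automaton_exists by blast
  then interpret history_automaton K "ctrls K" m .
  \<comment> \<open>The input is the number of \<open>K\<close> itself. The bound exceeds all core
    states and the last chain state \<open>2 * core_code\<close>, and it is computable from that
    number.\<close>
  define M where "M = automaton core_code (Suc (2 * core_code))"
  define v :: nat where "v = (if ?P M then 1 else 0)"
  have "checking_stack_automaton M"
    unfolding M_def by (rule checking_stack_automaton_automaton) auto
  from f[OF this] have "computes f [sa_code M] v" by (simp add: v_def)
  moreover have "computes c [core_code] (sa_code M)"
    unfolding M_def sa_code_automaton by (rule c)
  ultimately have "computes g [core_code] v"
    unfolding g_def by (intro computes.comp[of _ _ "[sa_code M]"]) simp_all
  from diagonal_halts_iff[OF this] have "(\<exists>x. runs (K, (\<lambda>_. 0)(1 := Suc core_code)) ([], x)) \<longleftrightarrow> v = 0"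
    by (simp add: K_def)
  moreover have "?P M \<longleftrightarrow> (\<exists>t. ctrl core_code t = [])"
    unfolding M_def using m_less_core_code by (intro weak_space_bounded_iff) simp
  moreover have "(\<exists>t. ctrl core_code t = []) \<longleftrightarrow> (\<exists>x. runs (K, (\<lambda>_. 0)(1 := Suc core_code)) ([], x))"
    by (auto simp: ctrl_def conf_def runs_def prod_eq_iff)
  \<comment> \<open>Bounded space means \<open>v = 1\<close> by definition of \<open>v\<close>, but
    by the equivalences it means that \<open>K\<close> halts, that is \<open>v = 0\<close>.\<close>
  ultimately show False by (simp add: v_def split: if_splits)
qed

end
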